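(* If $\alpha$ is a nested word and $\mathcal R^{\alpha}$ is the path-star hereditary class of graphs defined by $\alpha$, then $\mathcal R^{\alpha}$ does not contain a minimal class; that is, no hereditary class $\mathcal D\subseteq\mathcal R^{\alpha}$ is a minimal hereditary class of unbounded tree-width.
   Context: $\mathbb N=\{1,2,3,\dots\}$. A word is a finite or infinite sequence of letters; letters are natural numbers, and $\alpha_j$ is the $j$-th letter of $\alpha$. For a word $\alpha$ over an alphabet $\mathcal A$ and $\mathcal S\subseteq\mathcal A$, $\alpha^{\mathcal S}$ denotes the word obtained from $\alpha$ by deleting all letters not in $\mathcal S$ (keeping the order of the remaining letters). Branched words: a word $\alpha$ over an alphabet $\mathcal A\subseteq\mathbb N$ is branched, with base set $\mathcal B$ and branch sets $\mathcal H_1,\mathcal H_2,\dots$, if $\mathcal A$ is partitioned into a finite base set $\mathcal B$ and (finitely or infinitely many) branch sets $\mathcal H_1,\mathcal H_2,\dots$, each finite or infinite and ordered by the order inherited from $\mathbb N$, such that in $\alpha$: a base letter can appear immediately after any other letter; the first (smallest) letter of a branch set can appear only immediately after a base letter (or as the first letter of the word); any other letter of a branch set $\mathcal H_i$ can appear only immediately after the letter preceding it in the order of $\mathcal H_i$. Nested words: let $\alpha$ be an infinite branched word over an infinite alphabet $\mathcal A\subseteq\mathbb N$ with base set $\mathcal B_\alpha$ and branch sets $\mathcal H^{\alpha}_1,\mathcal H^{\alpha}_2,\dots$, in which each letter of $\mathcal A$ appears infinitely many times. For a positive integer $\mathfrak b$, $\alpha$ is $\mathfrak b$-nested if every subset $\mathcal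 S\subseteq\mathcal A$ can be partitioned into a base set $\mathcal B_{\mathcal S}$ and ordered (possibly empty) branch sets $\mathcal H^{\mathcal S}_1,\mathcal H^{\mathcal S}_2,\dots$ such that $|\mathcal B_{\mathcal S}|\le\mathfrak b$, $\alpha^{\mathcal S}$ is a branched word with base set $\mathcal B_{\mathcal S}$ and these branch sets, and $\mathcal H^{\mathcal S}_i\subseteq\mathcal H^{\alpha}_i$ with the same ordering for each $i$. A word is nested if it is $\mathfrak b$-nested for some positive integer $\mathfrak b$. Path-star classes: the infinite graph $R^{\alpha}=(V_P\cup V_S,\;E_P\cup E_S)$ has path-vertices $V_P=\{p_j: j\in\mathbb N\}$, star-vertices $V_S=\{s_i: i\in\mathbb N\}$, path edges $E_P=\{p_jp_{j+1}: j\in\mathbb N\}$ and star edges $E_S=\{p_js_{\alpha_j}: j\in\mathbb N\}$. $\mathcal R^{\alpha}$ is the class of all finite induced subgraphs of $R^{\alpha}$ (up to isomorphism). A class of graphs is hereditary if it is closed under taking induced subgraphs. A hereditary class $\mathcal D$ is minimal of unbounded tree-width if $\mathcal D$ has unbounded tree-width and every proper hereditary subclass of $\mathcal D$ has bounded tree-width. *)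

theory Defs
  imports Main "HOL-Library.Infinite_Set" "HOL-Library.Disjoint_Sets"
begin

(* The positive integers 1, 2, 3, ... are represented throughout (letters, positions in a word,
   indices of path- and star-vertices, indices of branch sets) by the type nat, via the order
   isomorphism n |-> n + 1.  In particular the first letter of a word sits at position 0. *)

section \<open>Words\<close>

datatype word = Finite_Word "nat list" | Infinite_Word "nat \<Rightarrow> nat"

fun letter_at :: "word \<Rightarrow> nat \<Rightarrow> nat option" where
  "letter_at (Finite_Word xs) j = (if j < length xs then Some (xs ! j) else None)"
| "letter_at (Infinite_Word f) j = Some (f j)"

fun restrict_word :: "word \<Rightarrow> nat set \<Rightarrow> word" where
  "restrict_word (Finite_Word xs) S = Finite_Word (filter (\<lambda>x. x \<in> S) xs)"
| "restrict_word (Infinite_Word f) S =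
    (let J = {j. f j \<in> S} in
     if finite J then Finite_Word (map f (sorted_list_of_set J))
     else Infinite_Word (\<lambda>n. f (enumerate J n)))"

(* Branch sets form a family H indexed by nat; a finite list of branch sets is padded with empty
   sets.  Base letters are unconstrained: they may follow any letter, including themselves (as
   they must, since restricting a nested word to one letter a gives the word a a a ...). *)
definition branched :: "word \<Rightarrow> nat set \<Rightarrow> nat set \<Rightarrow> (nat \<Rightarrow> nat set) \<Rightarrow> bool" where
  "branched w A B H \<longleftrightarrow>
     (\<forall>j x. letter_at w j = Some x \<longrightarrow> x \<in> A) \<and>
     finite B \<and> A = B \<union> (\<Union>i. H i) \<and> B \<inter> (\<Union>i. H i) = {} \<and> disjoint_family H \<and>
     (\<forall>i j. \<forall>x \<in> H i. letter_at w j = Some x \<longrightarrow>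
        (if \<forall>y \<in> H i. x \<le> y
         then j = 0 \<or> (\<exists>b \<in> B. letter_at w (j - 1) = Some b)
         else j > 0 \<and> letter_at w (j - 1) = Some (Max {y \<in> H i. y < x})))"

definition b_nested :: "nat \<Rightarrow> (nat \<Rightarrow> nat) \<Rightarrow> bool" where
  "b_nested b \<alpha> \<longleftrightarrow>
     (\<exists>A B H. infinite A \<and> branched (Infinite_Word \<alpha>) A B H \<and>
        (\<forall>x \<in> A. infinite {j. \<alpha> j = x}) \<and>
        (\<forall>S \<subseteq> A. \<exists>B\<^sub>S H\<^sub>S. card B\<^sub>S \<le> b \<and>
           branched (restrict_word (Infinite_Word \<alpha>) S) S B\<^sub>S H\<^sub>S \<and>
           (\<forall>i. H\<^sub>S i \<subseteq> H i)))"

definition nested :: "(nat \<Rightarrow> nat) \<Rightarrow> bool" where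
  "nested \<alpha> \<longleftrightarrow> (\<exists>b \<ge> 1. b_nested b \<alpha>)"

section \<open>Graphs\<close>

type_synonym 'a graph = "'a set \<times> 'a set set"

abbreviation verts :: "'a graph \<Rightarrow> 'a set" where "verts \<equiv> fst"
abbreviation edges :: "'a graph \<Rightarrow> 'a set set" where "edges \<equiv> snd"

definition simple_graph :: "'a graph \<Rightarrow> bool" where
  "simple_graph G \<longleftrightarrow> (\<forall>e \<in> edges G. e \<subseteq> verts G \<and> card e = 2)"

definition induced_subgraph :: "'a graph \<Rightarrow> 'a set \<Rightarrow> 'a graph" where
  "induced_subgraph G W = (W, {e \<in> edges G. e \<subseteq> W})"

definition isomorphic :: "'a graph \<Rightarrow> 'b graph \<Rightarrow> bool" where
  "isomorphic G H \<longleftrightarrow>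
     (\<exists>f. bij_betw f (verts G) (verts H) \<and>
          (\<forall>u \<in> verts G. \<forall>v \<in> verts G. {u, v} \<in> edges G \<longleftrightarrow> {f u, f v} \<in> edges H))"

definition walk :: "'a graph \<Rightarrow> 'a list \<Rightarrow> bool" where
  "walk G xs \<longleftrightarrow> xs \<noteq> [] \<and> set xs \<subseteq> verts G \<and> successively (\<lambda>u v. {u, v} \<in> edges G) xs"

definition connected_graph :: "'a graph \<Rightarrow> bool" where
  "connected_graph G \<longleftrightarrow> verts G \<noteq> {} \<and>
     (\<forall>u \<in> verts G. \<forall>v \<in> verts G. \<exists>xs. walk G xs \<and> hd xs = u \<and> last xs = v)"

definition cycle :: "'a graph \<Rightarrow> 'a list \<Rightarrow> bool" where
  "cycle G xs \<longleftrightarrow> walk G xs \<and> distinct xs \<and> length xs \<ge> 3 \<and> {last xs, hd xs} \<in> edges G"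

definition tree :: "'a graph \<Rightarrow> bool" where
  "tree T \<longleftrightarrow> simple_graph T \<and> finite (verts T) \<and> connected_graph T \<and> (\<nexists>xs. cycle T xs)"

section \<open>Tree-width\<close>

definition tree_decomposition :: "'a graph \<Rightarrow> 'b graph \<Rightarrow> ('b \<Rightarrow> 'a set) \<Rightarrow> bool" where
  "tree_decomposition G T bag \<longleftrightarrow>
     tree T \<and>
     (\<Union>t \<in> verts T. bag t) = verts G \<and>
     (\<forall>e \<in> edges G. \<exists>t \<in> verts T. e \<subseteq> bag t) \<and>
     (\<forall>v \<in> verts G. connected_graph (induced_subgraph T {t \<in> verts T. v \<in> bag t}))"

(* Truncated subtraction gives the graph without vertices width 0 instead of -1. *)
definition decomposition_width :: "'b graph \<Rightarrow> ('b \<Rightarrow> 'a set) \<Rightarrow> nat" where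
  "decomposition_width T bag = Max ((\<lambda>t. card (bag t)) ` verts T) - 1"

(* Meant for finite graphs.  Decomposition trees are finite, so nodes of type nat suffice. *)
definition treewidth :: "'a graph \<Rightarrow> nat" where
  "treewidth G = (LEAST k. \<exists>(T :: nat graph) bag.
     tree_decomposition G T bag \<and> decomposition_width T bag = k)"

section \<open>Graph classes\<close>

(* Every finite graph is isomorphic to one with vertices in nat, so isomorphism-closed classes of
   finite graphs are modelled as isomorphism-closed sets of graphs on subsets of nat. *)
definition hereditary :: "nat graph set \<Rightarrow> bool" where
  "hereditary C \<longleftrightarrow>
     (\<forall>G \<in> C. simple_graph G \<and> finite (verts G)) \<and>
     (\<forall>G \<in> C. \<forall>G'. simple_graph G' \<and> isomorphic G G' \<longrightarrow> G' \<in> C) \<and>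
     (\<forall>G \<in> C. \<forall>W \<subseteq> verts G. induced_subgraph G W \<in> C)"

definition bounded_treewidth :: "nat graph set \<Rightarrow> bool" where
  "bounded_treewidth C \<longleftrightarrow> (\<exists>k. \<forall>G \<in> C. treewidth G \<le> k)"

definition minimal_unbounded_treewidth :: "nat graph set \<Rightarrow> bool" where
  "minimal_unbounded_treewidth D \<longleftrightarrow>
     hereditary D \<and> \<not> bounded_treewidth D \<and>
     (\<forall>D'. hereditary D' \<and> D' \<subset> D \<longrightarrow> bounded_treewidth D')"

section \<open>Path-star classes\<close>

datatype ps_vertex = Path_Vertex nat | Star_Vertex nat

definition path_star_graph :: "(nat \<Rightarrow> nat) \<Rightarrow> ps_vertex graph" where
  "path_star_graph \<alpha> =
     (range Path_Vertex \<union> range Star_Vertex,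
      range (\<lambda>j. {Path_Vertex j, Path_Vertex (Suc j)}) \<union>
      range (\<lambda>j. {Path_Vertex j, Star_Vertex (\<alpha> j)}))"

definition path_star_class :: "(nat \<Rightarrow> nat) \<Rightarrow> nat graph set" where
  "path_star_class \<alpha> =
     {G. simple_graph G \<and>
         (\<exists>W \<subseteq> verts (path_star_graph \<alpha>). finite W \<and>
            isomorphic G (induced_subgraph (path_star_graph \<alpha>) W))}"

end

theory Submission
  imports Defs
begin

text \<open>
  Let \<open>D\<close> be a hereditary class of path-star graphs of a nested word with unbounded tree-width. The
  idea is that members of huge tree-width contain induced subgraphs that still have large tree-width but
  in which the star vertices are attached to the path at positions far apart from each other (lemma
  \<open>wide_contains_spread_wide\<close>). Small induced subgraphs of such a graph have tree-width at most
  \<open>8\<close>, because no short piece of the path meets two stars. Fix a member \<open>F\<close> of \<open>D\<close> of tree-width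
  above \<open>8\<close>, with \<open>g\<close> vertices. The members of \<open>D\<close> all of whose induced subgraphs on at most
  \<open>g\<close> vertices have tree-width at most \<open>8\<close> form a hereditary class. It is a proper subclass, since
  it lacks \<open>F\<close>, and its tree-width is unbounded, since it contains the graphs with stars spread out
  further than \<open>g\<close>. So \<open>D\<close> is not minimal.

  To find these graphs, take the finite set \<open>S\<close> of star letters of a given graph and peel off base
  sets: the layer \<open>0\<close> is the base set of \<open>S\<close>, the layer \<open>1\<close> the base set of the remaining letters,
  and so on. Each layer has at most \<open>b\<close> letters, and a stretch of the word that misses a layer spells,
  as far as deeper letters are concerned, consecutive letters of one branch. If many disjoint intervals of
  the path meet each of the first \<open>t\<close> layers, then by the pigeonhole principle many of them share a
  letter from each layer, which yields a complete bipartite minor. Otherwise it costs few path vertices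
  and the stars of \<open>t\<close> layers to destroy all these intervals. The remaining pieces of the path spell
  consecutive letters. Either some window of consecutive letters is crossed by many pieces, which
  again yields a complete bipartite minor, or sweeping over the windows gives a tree-decomposition of
  small width (lemma \<open>decomposes_path_star\<close>).

  In both minors the letters can be thinned out, keeping every \<open>(g+1)\<close>-st letter of each branch.
  Afterwards two occurrences of remaining letters are more than \<open>g\<close> apart (lemma \<open>spread_if_thin\<close>):
  they are separated by letters of \<open>g\<close> layers, or by \<open>g\<close> letters of their branch that have been
  thinned out. Thinning out letters removes star vertices only and leaves the path as it is.

  Tree-width is bounded from below by the bramble argument (lemma \<open>treewidth_ge_bipartite_minor\<close>), which
  rests on the Helly property of subtrees, and from above by building tree-decompositions bag by bag.
\<close>

section \<open>Connectivity and trees\<close>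

definition adjacency :: "'a graph \<Rightarrow> ('a \<times> 'a) set" where
  "adjacency G = {(u, v). u \<in> verts G \<and> v \<in> verts G \<and> {u, v} \<in> edges G}"

lemma walk_imp_rtrancl_adjacency:
  assumes "walk G xs"
  shows "(hd xs, last xs) \<in> (adjacency G)\<^sup>*"
  using assms
proof (induction xs)
  case Nil
  then show ?case by (simp add: walk_def)
next
  case (Cons x xs)
  show ?case
  proof (cases xs)
    case Nil
    then show ?thesis by simp
  next
    case (Cons y ys)
    have "walk G xs" "(x, y) \<in> adjacency G"
      using Cons.prems Cons by (auto simp: walk_def adjacency_def)
    then show ?thesis
      using Cons.IH Cons by (auto intro: converse_rtrancl_into_rtrancl)
  qed
qed

lemma rtrancl_adjacency_imp_walk:
  assumes "(u, v) \<in> (adjacency G)\<^sup>*" and "u \<in> verts G"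
  shows "\<exists>xs. walk G xs \<and> hd xs = u \<and> last xs = v"
  using assms
proof (induction rule: rtrancl_induct)
  case base
  then have "walk G [u]" by (simp add: walk_def)
  then show ?case by (intro exI[of _ "[u]"]) simp
next
  case (step v w)
  then obtain xs where "walk G xs" "hd xs = u" "last xs = v" by blast
  then have "walk G (xs @ [w]) \<and> hd (xs @ [w]) = u \<and> last (xs @ [w]) = w"
    using step.hyps by (auto simp: walk_def adjacency_def successively_append_iff)
  then show ?case by blast
qed

lemma connected_graph_iff_rtrancl:
  "connected_graph G \<longleftrightarrow>
     verts G \<noteq> {} \<and> (\<forall>u \<in> verts G. \<forall>v \<in> verts G. (u, v) \<in> (adjacency G)\<^sup>*)"
  unfolding connected_graph_def
  using walk_imp_rtrancl_adjacency rtrancl_adjacency_imp_walk by metis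

definition add_leaf :: "'a \<Rightarrow> 'a \<Rightarrow> 'a graph \<Rightarrow> 'a graph" where
  "add_leaf n t T = (insert n (verts T), insert {n, t} (edges T))"

lemma connected_add_leaf:
  assumes "connected_graph T" and "t \<in> verts T"
  shows "connected_graph (add_leaf n t T)"
proof -
  have sub: "(adjacency T)\<^sup>* \<subseteq> (adjacency (add_leaf n t T))\<^sup>*"
    by (rule rtrancl_mono) (auto simp: adjacency_def add_leaf_def)
  have nt: "(n, t) \<in> adjacency (add_leaf n t T)" "(t, n) \<in> adjacency (add_leaf n t T)"
    using assms(2) by (auto simp: adjacency_def add_leaf_def insert_commute)
  have "(u, t) \<in> (adjacency (add_leaf n t T))\<^sup>* \<and> (t, u) \<in> (adjacency (add_leaf n t T))\<^sup>*"
    if "u \<in> insert n (verts T)" for u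
  proof (cases "u = n")
    case True
    then show ?thesis using nt by blast
  next
    case False
    then have "(u, t) \<in> (adjacency T)\<^sup>*" "(t, u) \<in> (adjacency T)\<^sup>*"
      using that assms by (auto simp: connected_graph_iff_rtrancl)
    then show ?thesis using sub by blast
  qed
  then show ?thesis
    unfolding connected_graph_iff_rtrancl
    by (auto simp: add_leaf_def intro: rtrancl_trans)
qed

text \<open>In a cycle through the new vertex \<open>n\<close>, both neighbours would have to be \<open>t\<close>.\<close>

lemma tree_add_leaf:
  assumes T: "tree T" and t: "t \<in> verts T" and n: "n \<notin> verts T"
  shows "tree (add_leaf n t T)"
proof -
  let ?T = "add_leaf n t T"
  have simple: "simple_graph ?T"
  proof -
    have "n \<noteq> t" using t n by blast
    then have "card {n, t} = 2" by simp
    then show ?thesis using T t by (auto simp: tree_def simple_graph_def add_leaf_def)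
  qed
  have inT: "{u, v} \<in> edges T" if "{u, v} \<in> edges ?T" "u \<noteq> n" "v \<noteq> n" for u v
    using that by (auto simp: add_leaf_def doubleton_eq_iff)
  have nbr: "u = t" if "{u, n} \<in> edges ?T" for u
    using that n T by (auto simp: add_leaf_def doubleton_eq_iff tree_def simple_graph_def)
  have nbr': "u = t" if "{n, u} \<in> edges ?T" for u
    using nbr that by (simp add: insert_commute)
  have False if c: "cycle ?T xs" for xs
  proof (cases "n \<in> set xs")
    case False
    have "walk T xs"
      unfolding walk_def
    proof (intro conjI)
      show "successively (\<lambda>u v. {u, v} \<in> edges T) xs"
      proof (rule successively_mono)
        show "successively (\<lambda>u v. {u, v} \<in> edges ?T) xs" using c by (simp add: cycle_def walk_def)
      qed (use False inT in blast)
    qed (use c False in \<open>auto simp: cycle_def walk_def add_leaf_def\<close>)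
    moreover have "{last xs, hd xs} \<in> edges T"
      using c False by (intro inT) (auto simp: cycle_def walk_def)
    ultimately have "cycle T xs" using c by (simp add: cycle_def)
    then show False using T by (auto simp: tree_def)
  next
    case True
    then obtain ys zs where xs: "xs = ys @ n # zs" by (meson split_list)
    have succ: "successively (\<lambda>u v. {u, v} \<in> edges ?T) xs" and d: "distinct xs"
      and len: "length xs \<ge> 3" and wrap: "{last xs, hd xs} \<in> edges ?T"
      using c by (auto simp: cycle_def walk_def)
    have ys: "last ys = t" if "ys \<noteq> []"
      using succ that unfolding xs successively_append_iff by (intro nbr) simp
    have zs: "hd zs = t" if ne: "zs \<noteq> []"
    proof -
      obtain z zs' where "zs = z # zs'" using ne by (cases zs) auto
      then show ?thesis using succ nbr' unfolding xs successively_append_iff by simp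
    qed
    show False
    proof (cases "ys = [] \<or> zs = []")
      case False
      then have "t \<in> set ys" "t \<in> set zs" using ys zs last_in_set[of ys] hd_in_set[of zs] by auto
      then show False using d by (auto simp: xs)
    next
      case True
      moreover have "\<not> (ys = [] \<and> zs = [])" using len by (auto simp: xs)
      ultimately consider "ys = []" "zs \<noteq> []" | "ys \<noteq> []" "zs = []" by blast
      then show False
      proof cases
        case 1
        then have "last zs = t" using wrap by (intro nbr) (simp add: xs)
        moreover obtain z zs' where z: "zs = z # zs'" using 1 by (cases zs) auto
        moreover have "zs' \<noteq> []" using len xs 1 z by auto
        ultimately show False using zs 1 d by (auto simp: xs)
      next
        case 2
        then have "hd ys = t" using wrap by (intro nbr') (simp add: xs)
        moreover obtain y ys' where y: "ys = y # ys'" using 2 by (cases ys) auto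
        moreover have "ys' \<noteq> []" using len xs 2 y by auto
        ultimately show False using ys 2 d by (auto simp: xs)
      qed
    qed
  qed
  moreover have "finite (verts ?T)" using T by (simp add: tree_def add_leaf_def)
  ultimately show ?thesis
    using simple connected_add_leaf[OF _ t, of n] T by (auto simp: tree_def)
qed

text \<open>Retracting a pendant vertex onto its neighbour maps edges to edges or to single vertices, so it
  keeps sets connected.\<close>

lemma rtrancl_remove_leaf:
  assumes "(u, v) \<in> (adjacency G)\<^sup>*"
    and "\<And>w. (w, n) \<in> adjacency G \<or> (n, w) \<in> adjacency G \<Longrightarrow> w = t"
    and "u \<noteq> n" "v \<noteq> n"
  shows "(u, v) \<in> (adjacency G \<inter> {(a, b). a \<noteq> n \<and> b \<noteq> n})\<^sup>*" (is "_ \<in> ?R\<^sup>*")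
proof -
  define \<rho> where "\<rho> x = (if x = n then t else x)" for x
  have "(\<rho> u, \<rho> v) \<in> ?R\<^sup>*"
    using assms(1)
  proof (induction rule: rtrancl_induct)
    case (step v w)
    have "\<rho> v = \<rho> w \<or> (\<rho> v, \<rho> w) \<in> ?R"
      using step(2) assms(2) unfolding \<rho>_def by auto
    then show ?case
    proof
      assume "(\<rho> v, \<rho> w) \<in> ?R"
      then show ?thesis by (rule rtrancl_into_rtrancl[OF step(3)])
    qed (use step(3) in simp)
  qed simp
  then show ?thesis using assms(3,4) by (simp add: \<rho>_def)
qed

text \<open>The first vertex of a longest path has its successor as only neighbour: another neighbour would
  prolong the path or close a cycle.\<close>

lemma tree_remove_leaf:
  assumes T: "tree T" and "card (verts T) \<ge> 2"
  obtains n t T0 where "tree T0" "t \<in> verts T0" "n \<notin> verts T0" "T = add_leaf n t T0"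
proof -
  have sg: "simple_graph T" and fin: "finite (verts T)" and con: "connected_graph T"
    and acyc: "\<And>xs. \<not> cycle T xs"
    using T by (auto simp: tree_def)
  have loop: "{u, u} \<notin> edges T" for u using sg by (force simp: simple_graph_def)
  define P where "P xs \<longleftrightarrow> walk T xs \<and> distinct xs" for xs
  obtain u v where uv: "u \<in> verts T" "v \<in> verts T" "u \<noteq> v"
    using assms(2) by (metis card_le_Suc0_iff_eq fin not_less_eq_eq numeral_2_eq_2)
  then have "(u, v) \<in> (adjacency T)\<^sup>*" using con by (auto simp: connected_graph_iff_rtrancl)
  with \<open>u \<noteq> v\<close> obtain w where "(u, w) \<in> adjacency T" by (meson converse_rtranclE)
  then have P2: "P [u, w]" using loop by (auto simp: P_def walk_def adjacency_def)
  have bound: "length xs \<le> card (verts T)" if "P xs" for xs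
    using that card_mono[OF fin, of "set xs"] distinct_card[of xs] by (auto simp: P_def walk_def)
  have "\<exists>xs. P xs \<and> (\<forall>ys. P ys \<longrightarrow> length ys \<le> length xs)"
    using P2 bound by (intro ex_has_greatest_nat[where b = "Suc (card (verts T))"]) (auto simp: less_Suc_eq_le)
  then obtain xs where Pxs: "P xs" and max: "\<And>ys. P ys \<Longrightarrow> length ys \<le> length xs"
    by blast
  have "length xs \<ge> 2" using max[OF P2] by simp
  then obtain n t rest where xs: "xs = n # t # rest" by (metis Suc_le_length_iff numeral_2_eq_2)
  have nt: "{n, t} \<in> edges T" "n \<in> verts T" "t \<in> verts T" "n \<noteq> t"
    using Pxs by (auto simp: P_def walk_def xs)
  \<comment> \<open>a neighbour off the path prolongs it, one on the path closes a cycle\<close>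
  have only: "w = t" if e: "{n, w} \<in> edges T" for w
  proof (rule ccontr)
    assume "w \<noteq> t"
    have w: "w \<in> verts T" "w \<noteq> n" using sg e loop by (auto simp: simple_graph_def)
    show False
    proof (cases "w \<in> set xs")
      case False
      then have "P (w # xs)"
        using Pxs e w by (auto simp: P_def walk_def xs insert_commute)
      then show False using max by fastforce
    next
      case True
      then obtain ys zs where "rest = ys @ w # zs"
        using \<open>w \<noteq> t\<close> w by (auto simp: xs dest: split_list)
      then have sp: "xs = (n # t # ys @ [w]) @ zs" by (simp add: xs)
      let ?c = "n # t # ys @ [w]"
      have "successively (\<lambda>u v. {u, v} \<in> edges T) (?c @ zs)"
        using Pxs unfolding P_def walk_def sp by blast
      then have "successively (\<lambda>u v. {u, v} \<in> edges T) ?c"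
        unfolding successively_append_iff by blast
      moreover have "set ?c \<subseteq> verts T" "distinct ?c"
        using Pxs unfolding P_def walk_def sp by auto
      ultimately have "cycle T ?c"
        using e by (simp add: cycle_def walk_def insert_commute)
      then show False using acyc by blast
    qed
  qed
  define T0 where "T0 = (verts T - {n}, edges T - {{n, t}})"
  have e2: "\<exists>a b. e = {a, b}" if "e \<in> edges T" for e
  proof -
    have "card e = 2" using sg that by (simp add: simple_graph_def)
    then show ?thesis by (auto simp: card_2_iff)
  qed
  have nin: "n \<notin> e" if e: "e \<in> edges T0" for e
  proof
    assume "n \<in> e"
    moreover obtain a b where "e = {a, b}" using e2[of e] e by (auto simp: T0_def)
    ultimately obtain w where "e = {n, w}" by auto
    then show False using e only by (auto simp: T0_def)
  qed
  have "tree T0"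
    unfolding tree_def
  proof (intro conjI notI)
    show "simple_graph T0" using sg nin by (auto simp: simple_graph_def T0_def)
    show "finite (verts T0)" using fin by (simp add: T0_def)
    show "connected_graph T0"
      unfolding connected_graph_iff_rtrancl
    proof (intro conjI ballI)
      show "verts T0 \<noteq> {}" using nt by (auto simp: T0_def)
    next
      fix a b assume ab: "a \<in> verts T0" "b \<in> verts T0"
      have "(a, b) \<in> (adjacency T \<inter> {(a, b). a \<noteq> n \<and> b \<noteq> n})\<^sup>*"
      proof (rule rtrancl_remove_leaf)
        show "(a, b) \<in> (adjacency T)\<^sup>*"
          using con ab by (auto simp: connected_graph_iff_rtrancl T0_def)
      next
        fix w assume "(w, n) \<in> adjacency T \<or> (n, w) \<in> adjacency T"
        then show "w = t" using only[of w] insert_commute[of n w "{}"] by (auto simp: adjacency_def)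
      qed (use ab in \<open>simp_all add: T0_def\<close>)
      moreover have "adjacency T \<inter> {(a, b). a \<noteq> n \<and> b \<noteq> n} \<subseteq> adjacency T0"
        by (auto simp: adjacency_def T0_def doubleton_eq_iff)
      ultimately show "(a, b) \<in> (adjacency T0)\<^sup>*" using rtrancl_mono by blast
    qed
  next
    assume "\<exists>xs. cycle T0 xs"
    then obtain xs where c: "cycle T0 xs" by blast
    have "successively (\<lambda>u v. {u, v} \<in> edges T) xs"
    proof (rule successively_mono)
      show "successively (\<lambda>u v. {u, v} \<in> edges T0) xs" using c by (simp add: cycle_def walk_def)
    qed (simp add: T0_def)
    then have "cycle T xs" using c by (auto simp: cycle_def walk_def T0_def)
    then show False using acyc by blast
  qed
  moreover have "T = add_leaf n t T0"
    using nt by (auto simp: T0_def add_leaf_def prod_eq_iff)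
  moreover have "t \<in> verts T0" "n \<notin> verts T0" using nt by (auto simp: T0_def)
  ultimately show thesis using that by blast
qed

text \<open>Helly property of subtrees: remove a pendant vertex \<open>n\<close>. If one of the sets is \<open>{n}\<close>, all contain
  \<open>n\<close>; otherwise every set containing \<open>n\<close> also contains its neighbour, so removing \<open>n\<close> keeps
  the sets connected and pairwise intersecting.\<close>

lemma tree_Helly:
  assumes "tree T"
    and "\<And>F. F \<in> \<F> \<Longrightarrow> F \<subseteq> verts T \<and> connected_graph (induced_subgraph T F)"
    and "\<And>F F'. F \<in> \<F> \<Longrightarrow> F' \<in> \<F> \<Longrightarrow> F \<inter> F' \<noteq> {}"
  shows "\<exists>t \<in> verts T. \<forall>F \<in> \<F>. t \<in> F"
  using assms
proof (induction "card (verts T)" arbitrary: T \<F> rule: less_induct)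
  case less
  have fin: "finite (verts T)" and ne: "verts T \<noteq> {}"
    using less.prems(1) by (auto simp: tree_def connected_graph_def)
  show ?case
  proof (cases "card (verts T) \<ge> 2")
    case False
    then have "card (verts T) = 1" using fin ne by (simp add: Suc_leI card_gt_0_iff le_antisym not_le)
    then obtain t where t: "verts T = {t}" by (auto simp: card_1_singleton_iff)
    have "F = {t}" if "F \<in> \<F>" for F using less.prems(2)[OF that] less.prems(3)[OF that that] t by auto
    then show ?thesis using t by auto
  next
    case True
    then obtain n t T0 where T0: "tree T0" "t \<in> verts T0" "n \<notin> verts T0"
      and T: "T = add_leaf n t T0"
      using tree_remove_leaf less.prems(1) by metis
    have nbr: "w = t" if "{w, n} \<in> edges T" for w
      using that T0 by (auto simp: T add_leaf_def doubleton_eq_iff tree_def simple_graph_def)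
    show ?thesis
    proof (cases "{n} \<in> \<F>")
      case True
      then have "n \<in> F" if "F \<in> \<F>" for F using less.prems(3) that by blast
      then show ?thesis by (auto simp: T add_leaf_def)
    next
      case False
      have nbrF: "w = t"
        if "(w, n) \<in> adjacency (induced_subgraph T F) \<or> (n, w) \<in> adjacency (induced_subgraph T F)"
        for w F
        using that nbr[of w] insert_commute[of n w "{}"]
        by (auto simp: adjacency_def induced_subgraph_def)
      have tF: "t \<in> F" if F: "F \<in> \<F>" "n \<in> F" for F
      proof -
        have "F \<noteq> {n}" using F(1) False by auto
        then obtain w where "w \<in> F" "w \<noteq> n" using F(2) by auto
        moreover have "verts (induced_subgraph T F) = F" by (simp add: induced_subgraph_def)
        ultimately have "(n, w) \<in> (adjacency (induced_subgraph T F))\<^sup>*"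
          using less.prems(2)[OF F(1)] F(2) unfolding connected_graph_iff_rtrancl by blast
        then obtain x where "(n, x) \<in> adjacency (induced_subgraph T F)"
          using \<open>w \<noteq> n\<close> by (auto elim: converse_rtranclE)
        then show ?thesis
          using nbrF[of x F] unfolding adjacency_def induced_subgraph_def by auto
      qed
      have "\<exists>t \<in> verts T0. \<forall>F \<in> (\<lambda>F. F - {n}) ` \<F>. t \<in> F"
      proof (rule less.hyps)
        show "card (verts T0) < card (verts T)"
          using T0 fin by (auto simp: T add_leaf_def)
        show "tree T0" by fact
      next
        fix G assume "G \<in> (\<lambda>F. F - {n}) ` \<F>"
        then obtain F where F: "F \<in> \<F>" and G: "G = F - {n}" by blast
        have FT: "F \<subseteq> verts T" "connected_graph (induced_subgraph T F)"
          using less.prems(2) F by auto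
        have "connected_graph (induced_subgraph T0 G)"
          unfolding connected_graph_iff_rtrancl
        proof (intro conjI ballI)
          have "F \<noteq> {}" using less.prems(3)[OF F F] by auto
          then show "verts (induced_subgraph T0 G) \<noteq> {}"
            using tF[OF F] T0 by (auto simp: induced_subgraph_def G)
        next
          fix a b assume ab: "a \<in> verts (induced_subgraph T0 G)" "b \<in> verts (induced_subgraph T0 G)"
          let ?R = "adjacency (induced_subgraph T F) \<inter> {(a, b). a \<noteq> n \<and> b \<noteq> n}"
          have "(a, b) \<in> ?R\<^sup>*"
          proof (rule rtrancl_remove_leaf)
            show "(a, b) \<in> (adjacency (induced_subgraph T F))\<^sup>*"
              using FT ab by (auto simp: connected_graph_iff_rtrancl induced_subgraph_def G)
          qed (use nbrF ab in \<open>auto simp: induced_subgraph_def G\<close>)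
          moreover have "?R \<subseteq> adjacency (induced_subgraph T0 G)"
            by (auto simp: adjacency_def induced_subgraph_def T G add_leaf_def doubleton_eq_iff)
          ultimately show "(a, b) \<in> (adjacency (induced_subgraph T0 G))\<^sup>*"
            using rtrancl_mono by blast
        qed
        then show "G \<subseteq> verts T0 \<and> connected_graph (induced_subgraph T0 G)"
          using FT by (auto simp: G T add_leaf_def)
      next
        fix G G' assume "G \<in> (\<lambda>F. F - {n}) ` \<F>" "G' \<in> (\<lambda>F. F - {n}) ` \<F>"
        then obtain F F' where F: "F \<in> \<F>" "F' \<in> \<F>" and G: "G = F - {n}" "G' = F' - {n}" by blast
        have tn: "t \<noteq> n" using T0 by auto
        obtain x where x: "x \<in> F" "x \<in> F'" using less.prems(3)[OF F] by blast
        show "G \<inter> G' \<noteq> {}"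
        proof (cases "x = n")
          case True
          then have "t \<in> G \<inter> G'" using tF F x tn by (auto simp: G)
          then show ?thesis by blast
        next
          case False
          then show ?thesis using x by (auto simp: G)
        qed
      qed
      then show ?thesis by (auto simp: T add_leaf_def)
    qed
  qed
qed

section \<open>Bounding tree-width from above\<close>

text \<open>The bags of a tree-decomposition, attached one after the other: the part of a new bag that has
  occurred before lies in the bag to which the new one is attached. The parameter bounds the
  sizes of the bags, so it exceeds the width by one.\<close>

inductive tree_bags :: "nat \<Rightarrow> 'a set set \<Rightarrow> bool" for k where
  single: "finite X \<Longrightarrow> card X \<le> k \<Longrightarrow> tree_bags k {X}"
| attach: "tree_bags k Bs \<Longrightarrow> Y \<in> Bs \<Longrightarrow> finite X \<Longrightarrow> card X \<le> k \<Longrightarrow> X \<inter> \<Union>Bs \<subseteq> Y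
    \<Longrightarrow> tree_bags k (insert X Bs)"

definition decomposes :: "nat \<Rightarrow> 'a graph \<Rightarrow> bool" where
  "decomposes k G \<longleftrightarrow>
     (\<exists>Bs. tree_bags k Bs \<and> \<Union>Bs = verts G \<and> (\<forall>e \<in> edges G. \<exists>X \<in> Bs. e \<subseteq> X))"

lemma tree_bags_nonempty: "tree_bags k Bs \<Longrightarrow> Bs \<noteq> {}"
  by (induction rule: tree_bags.induct) auto

lemma tree_bags_bounds:
  assumes "tree_bags k Bs" shows "finite Bs \<and> (\<forall>X \<in> Bs. finite X \<and> card X \<le> k)"
  using assms by (induction rule: tree_bags.induct) auto

text \<open>The tree of the decomposition grows by a pendant node for each new bag. For a vertex of the new bag
  that has occurred before, the node it is attached to already belongs to the subtree of that vertex.\<close>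

lemma tree_bags_imp_tree:
  assumes "tree_bags k Bs"
  shows "\<exists>(T :: nat graph) bag. tree T \<and> bag ` verts T = Bs \<and>
    (\<forall>v \<in> \<Union>Bs. connected_graph (induced_subgraph T {t \<in> verts T. v \<in> bag t}))"
  using assms
proof (induction rule: tree_bags.induct)
  case (single X)
  let ?T = "({0 :: nat}, {} :: nat set set)"
  have con: "connected_graph ?T" by (simp add: connected_graph_iff_rtrancl)
  then have "tree ?T"
    by (auto simp: tree_def simple_graph_def cycle_def)
  moreover have "connected_graph (induced_subgraph ?T {t \<in> verts ?T. v \<in> X})" if "v \<in> X" for v
  proof -
    have "induced_subgraph ?T {t \<in> verts ?T. v \<in> X} = ?T"
      using that by (simp add: induced_subgraph_def)
    then show ?thesis using con by simp
  qed
  moreover have "(\<lambda>_. X) ` verts ?T = {X}" by simp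
  ultimately show ?case
    by (intro exI[of _ ?T] exI[of _ "\<lambda>_. X"]) blast
next
  case (attach Bs Y X)
  from attach.IH obtain T :: "nat graph" and bag where T: "tree T" "bag ` verts T = Bs"
    and con: "\<And>v. v \<in> \<Union>Bs \<Longrightarrow> connected_graph (induced_subgraph T {t \<in> verts T. v \<in> bag t})"
    by blast
  obtain t where t: "t \<in> verts T" "bag t = Y" using T attach.hyps(2) by blast
  have "finite (verts T)" using T by (simp add: tree_def)
  then obtain n where n: "n \<notin> verts T" using ex_new_if_finite infinite_UNIV_nat by blast
  let ?T = "add_leaf n t T" and ?bag = "bag(n := X)"
  have bagT: "?bag s = bag s" if "s \<in> verts T" for s using that n by auto
  have sT: "e \<subseteq> verts T" if "e \<in> edges T" for e
    using that T by (auto simp: tree_def simple_graph_def)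
  have con': "connected_graph (induced_subgraph ?T {s \<in> verts ?T. v \<in> ?bag s})" if v: "v \<in> \<Union>(insert X Bs)" for v
  proof -
    let ?F = "{s \<in> verts T. v \<in> bag s}"
    have F: "{s \<in> verts ?T. v \<in> ?bag s} = (if v \<in> X then insert n ?F else ?F)"
      using n by (auto simp: add_leaf_def)
    consider "v \<notin> X" | "v \<in> X" "v \<in> \<Union>Bs" | "v \<in> X" "v \<notin> \<Union>Bs" by blast
    then show ?thesis
    proof cases
      case 1
      have "induced_subgraph ?T ?F = induced_subgraph T ?F"
        using n by (auto simp: induced_subgraph_def add_leaf_def)
      then show ?thesis using con[of v] v 1 F by simp
    next
      case 2
      have tF: "t \<in> ?F" using attach.hyps(5) 2 t by auto
      have "induced_subgraph ?T (insert n ?F) = add_leaf n t (induced_subgraph T ?F)"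
        using n sT tF by (auto simp: induced_subgraph_def add_leaf_def)
      moreover have "connected_graph (add_leaf n t (induced_subgraph T ?F))"
        using con[OF 2(2)] tF by (intro connected_add_leaf) (auto simp: induced_subgraph_def)
      ultimately show ?thesis using F 2 by auto
    next
      case 3
      then have "?F = {}" using T by blast
      then have "insert n ?F = {n}" by (simp only:)
      then have "{s \<in> verts ?T. v \<in> ?bag s} = {n}" using F 3(1) by metis
      then show ?thesis by (simp add: connected_graph_iff_rtrancl induced_subgraph_def)
    qed
  qed
  have "tree ?T" using tree_add_leaf[OF T(1) t(1) n] .
  moreover have "?bag ` verts ?T = insert X Bs"
  proof -
    have "?bag ` verts T = bag ` verts T" using bagT by (intro image_cong) auto
    then have "?bag ` insert n (verts T) = insert X Bs"
      unfolding image_insert T(2) by (simp only: fun_upd_same)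
    then show ?thesis by (simp only: add_leaf_def fst_conv)
  qed
  ultimately show ?case using con' by (intro exI[of _ ?T] exI[of _ ?bag] conjI ballI) assumption+
qed

lemma decomposes_imp_tree_decomposition:
  assumes "decomposes k G"
  shows "\<exists>(T :: nat graph) bag. tree_decomposition G T bag \<and> decomposition_width T bag \<le> k"
proof -
  obtain Bs where Bs: "tree_bags k Bs" "\<Union>Bs = verts G" "\<forall>e \<in> edges G. \<exists>X \<in> Bs. e \<subseteq> X"
    using assms by (auto simp: decomposes_def)
  obtain T :: "nat graph" and bag where T: "tree T" "bag ` verts T = Bs"
    "\<forall>v \<in> \<Union>Bs. connected_graph (induced_subgraph T {t \<in> verts T. v \<in> bag t})"
    using tree_bags_imp_tree[OF Bs(1)] by blast
  have dec: "tree_decomposition G T bag"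
    unfolding tree_decomposition_def
  proof (intro conjI)
    show "\<forall>e \<in> edges G. \<exists>t \<in> verts T. e \<subseteq> bag t"
      using Bs(3) T(2) by (metis imageE)
  qed (use T Bs in auto)
  have "Max ((\<lambda>t. card (bag t)) ` verts T) \<le> k"
  proof (rule Max.boundedI)
    show "finite ((\<lambda>t. card (bag t)) ` verts T)" using T by (simp add: tree_def)
    show "(\<lambda>t. card (bag t)) ` verts T \<noteq> {}" using T by (simp add: tree_def connected_graph_def)
    show "a \<le> k" if "a \<in> (\<lambda>t. card (bag t)) ` verts T" for a
      using that tree_bags_bounds[OF Bs(1)] T(2) by blast
  qed
  then have "decomposition_width T bag \<le> k"
    by (simp add: decomposition_width_def)
  with dec show ?thesis by blast
qed

lemma treewidth_le_if_decomposes: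
  assumes "decomposes k G"
  shows "treewidth G \<le> k"
proof -
  obtain T :: "nat graph" and bag where "tree_decomposition G T bag" and w: "decomposition_width T bag \<le> k"
    using decomposes_imp_tree_decomposition[OF assms] by blast
  then have "treewidth G \<le> decomposition_width T bag"
    unfolding treewidth_def by (intro Least_le) blast
  then show ?thesis using w by simp
qed

text \<open>The single bag of all vertices shows that some decomposition exists, so the least width is a width.\<close>

lemma treewidth_attained:
  assumes "simple_graph G" "finite (verts G)"
  obtains T :: "nat graph" and bag where "tree_decomposition G T bag" "decomposition_width T bag = treewidth G"
proof -
  have "decomposes (card (verts G)) G"
    unfolding decomposes_def
    using assms by (intro exI[of _ "{verts G}"]) (auto intro: tree_bags.single simp: simple_graph_def)
  then have "\<exists>k. \<exists>(T :: nat graph) bag. tree_decomposition G T bag \<and> decomposition_width T bag = k"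
    using decomposes_imp_tree_decomposition by blast
  from LeastI_ex[OF this] show thesis
    using that unfolding treewidth_def by blast
qed

text \<open>A few vertices can be put into every bag.\<close>

lemma tree_bags_add_everywhere:
  assumes "tree_bags k Bs" "finite X"
  shows "tree_bags (k + card X) ((\<lambda>Y. Y \<union> X) ` Bs)"
  using assms(1)
proof (induction rule: tree_bags.induct)
  case (single Y)
  have "card (Y \<union> X) \<le> k + card X" using single card_Un_le[of Y X] by linarith
  then show ?case using single assms(2) by (simp add: tree_bags.single)
next
  case (attach Bs Y Z)
  have "card (Z \<union> X) \<le> k + card X" using attach.hyps card_Un_le[of Z X] by linarith
  then have "tree_bags (k + card X) (insert (Z \<union> X) ((\<lambda>Y. Y \<union> X) ` Bs))"
    using attach assms(2) by (intro tree_bags.attach[where Y = "Y \<union> X"]) auto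
  then show ?case by simp
qed

lemma decomposes_add_vertices:
  assumes "decomposes k (induced_subgraph G W)" "finite X"
    and "simple_graph G"
  shows "decomposes (k + card X) (induced_subgraph G (W \<union> X))"
proof -
  obtain Bs where Bs: "tree_bags k Bs" "\<Union>Bs = W"
    "\<And>e. e \<in> edges G \<Longrightarrow> e \<subseteq> W \<Longrightarrow> \<exists>Y \<in> Bs. e \<subseteq> Y"
    using assms(1) by (auto simp: decomposes_def induced_subgraph_def)
  have ne: "Bs \<noteq> {}" using tree_bags_nonempty[OF Bs(1)] .
  have edge: "\<exists>Y \<in> Bs. e \<subseteq> Y \<union> X" if e: "e \<in> edges G" "e \<subseteq> W \<union> X" for e
  proof (cases "e \<subseteq> W")
    case True
    then show ?thesis using Bs(3)[OF e(1)] by blast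
  next
    case False
    have "card e = 2" using assms(3) e(1) by (simp add: simple_graph_def)
    then obtain a b where ab: "e = {a, b}" by (auto simp: card_2_iff)
    show ?thesis
    proof (cases "e \<subseteq> X")
      case True
      then show ?thesis using ne by (metis ex_in_conv le_supI2)
    next
      case no: False
      then obtain c where c: "c \<in> W" "e \<subseteq> insert c X"
        using False e(2) unfolding ab by blast
      then obtain Y where Y: "Y \<in> Bs" "c \<in> Y" using Bs(2) by blast
      then have "e \<subseteq> Y \<union> X" using c(2) by blast
      then show ?thesis using Y(1) by blast
    qed
  qed
  show ?thesis
    unfolding decomposes_def induced_subgraph_def fst_conv snd_conv
  proof (intro exI[of _ "(\<lambda>Y. Y \<union> X) ` Bs"] conjI ballI)
    show "tree_bags (k + card X) ((\<lambda>Y. Y \<union> X) ` Bs)"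
      by (rule tree_bags_add_everywhere[OF Bs(1) assms(2)])
    show "\<Union>((\<lambda>Y. Y \<union> X) ` Bs) = W \<union> X" using Bs(2) ne by auto
    show "\<exists>Y \<in> (\<lambda>Y. Y \<union> X) ` Bs. e \<subseteq> Y" if "e \<in> {e \<in> edges G. e \<subseteq> W \<union> X}" for e
      using edge[of e] that by simp
  qed
qed

section \<open>Isomorphisms and induced subgraphs\<close>

lemma induced_subgraph_twice:
  "U \<subseteq> W \<Longrightarrow> induced_subgraph (induced_subgraph G W) U = induced_subgraph G U"
  by (auto simp: induced_subgraph_def)

lemma simple_induced_subgraph: "simple_graph G \<Longrightarrow> simple_graph (induced_subgraph G W)"
  by (auto simp: simple_graph_def induced_subgraph_def)

lemma induced_subgraph_verts: "simple_graph G \<Longrightarrow> induced_subgraph G (verts G) = G"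
  by (auto simp: simple_graph_def induced_subgraph_def prod_eq_iff)

lemma isomorphic_sym:
  assumes "isomorphic G H" shows "isomorphic H G"
proof -
  obtain f where f: "bij_betw f (verts G) (verts H)"
    "\<And>u v. u \<in> verts G \<Longrightarrow> v \<in> verts G \<Longrightarrow> {u, v} \<in> edges G \<longleftrightarrow> {f u, f v} \<in> edges H"
    using assms by (auto simp: isomorphic_def)
  let ?g = "the_inv_into (verts G) f"
  have g: "bij_betw ?g (verts H) (verts G)" using f(1) by (rule bij_betw_the_inv_into)
  moreover have "f (?g u) = u" "?g u \<in> verts G" if "u \<in> verts H" for u
    using f(1) g that by (auto simp: f_the_inv_into_f_bij_betw bij_betwE)
  ultimately show ?thesis
    unfolding isomorphic_def using f(2) by (intro exI[of _ ?g]) auto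
qed

lemma isomorphic_induced_subgraph:
  assumes "isomorphic G H" "U \<subseteq> verts G"
  obtains U' where "U' \<subseteq> verts H" "card U' = card U"
    "isomorphic (induced_subgraph G U) (induced_subgraph H U')"
proof -
  obtain f where f: "bij_betw f (verts G) (verts H)"
    "\<And>u v. u \<in> verts G \<Longrightarrow> v \<in> verts G \<Longrightarrow> {u, v} \<in> edges G \<longleftrightarrow> {f u, f v} \<in> edges H"
    using assms(1) by (auto simp: isomorphic_def)
  have inj: "inj_on f U" using f(1) assms(2) by (auto simp: bij_betw_def intro: inj_on_subset)
  have "{u, v} \<in> edges G \<longleftrightarrow> {f u, f v} \<in> edges H" if "u \<in> U" "v \<in> U" for u v
    using that assms(2) f(2) by blast
  then have "isomorphic (induced_subgraph G U) (induced_subgraph H (f ` U))"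
    unfolding isomorphic_def induced_subgraph_def using inj
    by (intro exI[of _ f]) (auto simp: bij_betw_def)
  moreover have "f ` U \<subseteq> verts H" using f(1) assms(2) by (auto simp: bij_betw_def)
  ultimately show thesis using that inj card_image by blast
qed

lemma isomorphic_treewidth_le:
  assumes iso: "isomorphic G H" and G: "simple_graph G" "finite (verts G)" and H: "simple_graph H"
  shows "treewidth H \<le> treewidth G"
proof -
  obtain T :: "nat graph" and bag
    where T: "tree_decomposition G T bag" "decomposition_width T bag = treewidth G"
    using treewidth_attained[OF G] by blast
  obtain f where f: "bij_betw f (verts G) (verts H)"
    "\<And>u v. u \<in> verts G \<Longrightarrow> v \<in> verts G \<Longrightarrow> {u, v} \<in> edges G \<longleftrightarrow> {f u, f v} \<in> edges H"
    using iso by (auto simp: isomorphic_def)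
  have inj: "inj_on f (verts G)" and fG: "f ` verts G = verts H" using f(1) by (auto simp: bij_betw_def)
  have bag: "bag t \<subseteq> verts G" if "t \<in> verts T" for t
    using T(1) that by (auto simp: tree_decomposition_def)
  have "tree_decomposition H T (\<lambda>t. f ` bag t)"
    unfolding tree_decomposition_def
  proof (intro conjI ballI)
    show "tree T" using T(1) by (simp add: tree_decomposition_def)
    have "(\<Union>t \<in> verts T. f ` bag t) = f ` (\<Union>t \<in> verts T. bag t)" by blast
    then show "(\<Union>t \<in> verts T. f ` bag t) = verts H"
      using T(1) fG by (simp add: tree_decomposition_def)
  next
    fix e assume e: "e \<in> edges H"
    then obtain x y where xy: "e = {x, y}" "x \<in> verts H" "y \<in> verts H"
      using H by (force simp: simple_graph_def card_2_iff)
    then obtain u v where uv: "u \<in> verts G" "v \<in> verts G" "x = f u" "y = f v" using fG by blast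
    then have "{u, v} \<in> edges G" using f(2) e xy by simp
    then obtain t where "t \<in> verts T" "{u, v} \<subseteq> bag t"
      using T(1) by (auto simp: tree_decomposition_def)
    then show "\<exists>t \<in> verts T. e \<subseteq> f ` bag t" using xy uv by auto
  next
    fix x assume "x \<in> verts H"
    then obtain v where v: "v \<in> verts G" "x = f v" using fG by blast
    have "x \<in> f ` bag t \<longleftrightarrow> v \<in> bag t" if "t \<in> verts T" for t
      using inj bag[OF that] v by (auto simp: inj_on_def)
    then have "{t \<in> verts T. x \<in> f ` bag t} = {t \<in> verts T. v \<in> bag t}" by auto
    then show "connected_graph (induced_subgraph T {t \<in> verts T. x \<in> f ` bag t})"
      using T(1) v by (simp add: tree_decomposition_def)
  qed
  moreover have "decomposition_width T (\<lambda>t. f ` bag t) = treewidth G"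
  proof -
    have "card (f ` bag t) = card (bag t)" if "t \<in> verts T" for t
      using inj bag[OF that] by (auto intro: card_image inj_on_subset)
    then have "(\<lambda>t. card (f ` bag t)) ` verts T = (\<lambda>t. card (bag t)) ` verts T" by simp
    then show ?thesis using T(2) by (simp add: decomposition_width_def)
  qed
  ultimately show ?thesis unfolding treewidth_def[of H] by (intro Least_le) blast
qed

lemma isomorphic_finite:
  "isomorphic G H \<Longrightarrow> finite (verts G) \<longleftrightarrow> finite (verts H)"
  by (auto simp: isomorphic_def bij_betw_finite)

lemma isomorphic_treewidth_eq:
  assumes "isomorphic G H" "simple_graph G" "finite (verts G)" "simple_graph H"
  shows "treewidth H = treewidth G"
  using assms isomorphic_treewidth_le isomorphic_sym isomorphic_finite by (metis le_antisym)

section \<open>Bounding tree-width from below\<close>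

lemma adjacency_induced_mono:
  "A \<subseteq> B \<Longrightarrow> (adjacency (induced_subgraph T A))\<^sup>* \<subseteq> (adjacency (induced_subgraph T B))\<^sup>*"
  by (rule rtrancl_mono) (auto simp: adjacency_def induced_subgraph_def)

lemma connected_induced_Un:
  assumes "connected_graph (induced_subgraph T A)" "connected_graph (induced_subgraph T B)"
    and "A \<inter> B \<noteq> {}"
  shows "connected_graph (induced_subgraph T (A \<union> B))"
proof -
  obtain c where c: "c \<in> A" "c \<in> B" using assms(3) by blast
  let ?R = "adjacency (induced_subgraph T (A \<union> B))"
  have "(u, c) \<in> ?R\<^sup>* \<and> (c, u) \<in> ?R\<^sup>*" if u: "u \<in> A \<union> B" for u
  proof -
    have "u \<in> A \<Longrightarrow> (u, c) \<in> (adjacency (induced_subgraph T A))\<^sup>* \<and>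
        (c, u) \<in> (adjacency (induced_subgraph T A))\<^sup>*"
      using assms(1) c unfolding connected_graph_iff_rtrancl by (simp add: induced_subgraph_def)
    moreover have "u \<in> B \<Longrightarrow> (u, c) \<in> (adjacency (induced_subgraph T B))\<^sup>* \<and>
        (c, u) \<in> (adjacency (induced_subgraph T B))\<^sup>*"
      using assms(2) c unfolding connected_graph_iff_rtrancl by (simp add: induced_subgraph_def)
    ultimately show ?thesis
      using u adjacency_induced_mono[of A "A \<union> B" T] adjacency_induced_mono[of B "A \<union> B" T] by blast
  qed
  then have "(u, v) \<in> ?R\<^sup>*" if "u \<in> A \<union> B" "v \<in> A \<union> B" for u v
    using that rtrancl_trans[of u c ?R v] by blast
  moreover have "verts (induced_subgraph T (A \<union> B)) = A \<union> B" by (simp add: induced_subgraph_def)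
  ultimately show ?thesis
    unfolding connected_graph_iff_rtrancl using c by auto
qed

text \<open>The nodes of a single vertex are connected, and the node sets of adjacent vertices overlap in a bag
  containing the edge.\<close>

lemma tree_nodes_connected:
  assumes T: "tree_decomposition G T bag" and X: "X \<subseteq> verts G" "connected_graph (induced_subgraph G X)"
  shows "connected_graph (induced_subgraph T {t \<in> verts T. bag t \<inter> X \<noteq> {}})"
proof -
  let ?N = "{t \<in> verts T. bag t \<inter> X \<noteq> {}}"
  let ?R = "adjacency (induced_subgraph T ?N)"
  have node: "(t, s) \<in> ?R\<^sup>*"
    if v: "v \<in> X" and ts: "t \<in> verts T" "v \<in> bag t" "s \<in> verts T" "v \<in> bag s" for v t s
  proof -
    have "connected_graph (induced_subgraph T {t \<in> verts T. v \<in> bag t})"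
      using T v X(1) by (auto simp: tree_decomposition_def)
    then have "(t, s) \<in> (adjacency (induced_subgraph T {t \<in> verts T. v \<in> bag t}))\<^sup>*"
      using ts unfolding connected_graph_iff_rtrancl by (simp add: induced_subgraph_def)
    moreover have "{t \<in> verts T. v \<in> bag t} \<subseteq> ?N" using v by blast
    ultimately show ?thesis using adjacency_induced_mono by blast
  qed
  have reach: "\<forall>s \<in> verts T. w \<in> bag s \<longrightarrow> (t, s) \<in> ?R\<^sup>*"
    if vw: "(v, w) \<in> (adjacency (induced_subgraph G X))\<^sup>*"
      and v: "v \<in> X" "t \<in> verts T" "v \<in> bag t" for v w t
    using vw
  proof (induction rule: rtrancl_induct)
    case base
    then show ?case using node v by blast
  next
    case (step w w')
    have e: "{w, w'} \<in> edges G" "w \<in> X" "w' \<in> X"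
      using step.hyps(2) by (auto simp: adjacency_def induced_subgraph_def)
    then obtain s0 where s0: "s0 \<in> verts T" "w \<in> bag s0" "w' \<in> bag s0"
      using T by (auto simp: tree_decomposition_def)
    then have "(t, s0) \<in> ?R\<^sup>*" using step.IH by blast
    moreover have "\<forall>s \<in> verts T. w' \<in> bag s \<longrightarrow> (s0, s) \<in> ?R\<^sup>*"
      using node[OF e(3)] s0 by blast
    ultimately show ?case by (blast intro: rtrancl_trans)
  qed
  have "(t, s) \<in> ?R\<^sup>*" if t: "t \<in> ?N" and s: "s \<in> ?N" for t s
  proof -
    obtain v w where v: "v \<in> X" "v \<in> bag t" and w: "w \<in> X" "w \<in> bag s" using t s by blast
    have "(v, w) \<in> (adjacency (induced_subgraph G X))\<^sup>*"
      using X(2) v w unfolding connected_graph_iff_rtrancl by (simp add: induced_subgraph_def)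
    then show ?thesis using reach v w t s by blast
  qed
  moreover have "?N \<noteq> {}"
  proof -
    obtain v where "v \<in> X" using X(2) by (auto simp: connected_graph_def induced_subgraph_def)
    moreover have "v \<in> (\<Union>t \<in> verts T. bag t)"
      using T X(1) \<open>v \<in> X\<close> unfolding tree_decomposition_def by blast
    ultimately show ?thesis by blast
  qed
  ultimately show ?thesis
    unfolding connected_graph_iff_rtrancl by (simp add: induced_subgraph_def)
qed

text \<open>The sets \<open>X \<union> {s}\<close> form a bramble: by the Helly property some bag meets all of them, so it
  contains \<open>S\<close> or meets every member of \<open>\<X>\<close>.\<close>

lemma treewidth_ge_bipartite_minor:
  assumes G: "simple_graph G" "finite (verts G)"
    and X: "\<And>X. X \<in> \<X> \<Longrightarrow> X \<subseteq> verts G \<and> connected_graph (induced_subgraph G X)"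
    and "disjoint \<X>" "S \<subseteq> verts G"
    and edge: "\<And>X s. X \<in> \<X> \<Longrightarrow> s \<in> S \<Longrightarrow> \<exists>x \<in> X. {x, s} \<in> edges G"
    and "k \<le> card \<X>" "k \<le> card S"
  shows "k \<le> Suc (treewidth G)"
proof -
  obtain T :: "nat graph" and bag
    where T: "tree_decomposition G T bag" "decomposition_width T bag = treewidth G"
    using treewidth_attained[OF G] by blast
  have tree: "tree T" using T(1) by (simp add: tree_decomposition_def)
  define N where "N X = {t \<in> verts T. bag t \<inter> X \<noteq> {}}" for X
  have meet: "N X \<inter> N {s} \<noteq> {}" if "X \<in> \<X>" "s \<in> S" for X s
  proof -
    from edge[OF that] obtain x where x: "x \<in> X" "{x, s} \<in> edges G" by blast
    then obtain t where "t \<in> verts T" "{x, s} \<subseteq> bag t"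
      using T(1) unfolding tree_decomposition_def by blast
    then show ?thesis using x by (auto simp: N_def)
  qed
  have conN: "connected_graph (induced_subgraph T (N X))" if "X \<in> \<X>" for X
    using tree_nodes_connected[OF T(1)] X[OF that] by (simp add: N_def)
  have cons: "connected_graph (induced_subgraph T (N {s}))" if "s \<in> S" for s
    using T(1) that \<open>S \<subseteq> verts G\<close> by (auto simp: tree_decomposition_def N_def)
  have "\<exists>t \<in> verts T. \<forall>F \<in> {N X \<union> N {s} | X s. X \<in> \<X> \<and> s \<in> S}. t \<in> F"
  proof (rule tree_Helly[OF tree])
    fix F assume "F \<in> {N X \<union> N {s} | X s. X \<in> \<X> \<and> s \<in> S}"
    then obtain X s where F: "F = N X \<union> N {s}" "X \<in> \<X>" "s \<in> S" by blast
    then show "F \<subseteq> verts T \<and> connected_graph (induced_subgraph T F)"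
      using connected_induced_Un[OF conN[of X] cons[of s] meet] by (auto simp: N_def)
  next
    fix F F' assume "F \<in> {N X \<union> N {s} | X s. X \<in> \<X> \<and> s \<in> S}" "F' \<in> {N X \<union> N {s} | X s. X \<in> \<X> \<and> s \<in> S}"
    then obtain X s X' s' where "F = N X \<union> N {s}" "X \<in> \<X>" "F' = N X' \<union> N {s'}" "s' \<in> S" by blast
    then show "F \<inter> F' \<noteq> {}" using meet[of X s'] by blast
  qed
  then obtain t where t: "t \<in> verts T"
    and tF: "\<forall>F \<in> {N X \<union> N {s} | X s. X \<in> \<X> \<and> s \<in> S}. t \<in> F" ..
  have hit: "t \<in> N X \<or> t \<in> N {s}" if "X \<in> \<X>" "s \<in> S" for X s
    using tF that by blast
  have fin: "finite (bag t)"
    using T(1) t G(2) unfolding tree_decomposition_def by (metis UN_upper finite_subset)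
  have "k \<le> card (bag t)"
  proof (cases "\<forall>X \<in> \<X>. t \<in> N X")
    case True
    then have "\<forall>X \<in> \<X>. \<exists>x. x \<in> bag t \<inter> X" by (auto simp: N_def)
    then obtain f where f: "\<And>X. X \<in> \<X> \<Longrightarrow> f X \<in> bag t \<inter> X" by metis
    have "inj_on f \<X>"
    proof (rule inj_onI)
      fix X Y assume XY: "X \<in> \<X>" "Y \<in> \<X>" "f X = f Y"
      then have "X \<inter> Y \<noteq> {}" using f[of X] f[of Y] by auto
      then show "X = Y" using \<open>disjoint \<X>\<close> XY by (auto simp: disjoint_def)
    qed
    moreover have "f ` \<X> \<subseteq> bag t" using f by blast
    ultimately have "card \<X> \<le> card (bag t)" using card_inj_on_le fin by blast
    then show ?thesis using \<open>k \<le> card \<X>\<close> by simp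
  next
    case False
    then obtain X where "X \<in> \<X>" "t \<notin> N X" by blast
    then have "t \<in> N {s}" if "s \<in> S" for s using hit[OF _ that] by blast
    then have "S \<subseteq> bag t" unfolding N_def by blast
    then have "card S \<le> card (bag t)" by (rule card_mono[OF fin])
    then show ?thesis using \<open>k \<le> card S\<close> by simp
  qed
  moreover have "card (bag t) \<le> Max ((\<lambda>t. card (bag t)) ` verts T)"
    using t tree by (intro Max_ge) (auto simp: tree_def)
  ultimately show ?thesis using T(2) by (simp add: decomposition_width_def)
qed

section \<open>Path-star graphs crossed by many intervals\<close>

definition path_star_subgraph :: "(nat \<Rightarrow> nat) \<Rightarrow> nat set \<Rightarrow> nat set \<Rightarrow> ps_vertex graph" where
  "path_star_subgraph \<alpha> P S =
     induced_subgraph (path_star_graph \<alpha>) (Path_Vertex ` P \<union> Star_Vertex ` S)"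

text \<open>Contracting the intervals and taking the stars of \<open>C\<close> gives a complete bipartite minor with
  \<open>k\<close> and \<open>card C\<close> vertices on the two sides.\<close>

definition crossed :: "(nat \<Rightarrow> nat) \<Rightarrow> nat set \<Rightarrow> nat set \<Rightarrow> nat \<Rightarrow> bool" where
  "crossed \<alpha> P C k \<longleftrightarrow> (\<exists>\<I>. finite \<I> \<and> k \<le> card \<I> \<and> disjoint \<I> \<and>
     (\<forall>I \<in> \<I>. I \<subseteq> P \<and> C \<subseteq> \<alpha> ` I \<and> (\<exists>l r. l \<le> r \<and> I = {l..r})))"

lemma crossed_mono: "crossed \<alpha> P C k \<Longrightarrow> P \<subseteq> P' \<Longrightarrow> C' \<subseteq> C \<Longrightarrow> crossed \<alpha> P' C' k"
  unfolding crossed_def by (meson subset_trans)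

lemma simple_path_star_graph: "simple_graph (path_star_graph \<alpha>)"
  by (auto simp: simple_graph_def path_star_graph_def)

lemma simple_path_star_subgraph: "simple_graph (path_star_subgraph \<alpha> P S)"
  by (simp add: path_star_subgraph_def simple_induced_subgraph simple_path_star_graph)

lemma verts_path_star_subgraph: "verts (path_star_subgraph \<alpha> P S) = Path_Vertex ` P \<union> Star_Vertex ` S"
  by (simp add: path_star_subgraph_def induced_subgraph_def)

lemma edges_path_star_subgraph:
  "edges (path_star_subgraph \<alpha> P S) =
     {{Path_Vertex p, Path_Vertex (Suc p)} | p. p \<in> P \<and> Suc p \<in> P} \<union>
     {{Path_Vertex p, Star_Vertex (\<alpha> p)} | p. p \<in> P \<and> \<alpha> p \<in> S}"
  unfolding path_star_subgraph_def induced_subgraph_def path_star_graph_def by auto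

lemma connected_interval:
  assumes "l \<le> r" "{l..r} \<subseteq> P"
  shows "connected_graph (induced_subgraph (path_star_subgraph \<alpha> P S) (Path_Vertex ` {l..r}))"
proof -
  let ?G = "induced_subgraph (path_star_subgraph \<alpha> P S) (Path_Vertex ` {l..r})"
  have v: "verts ?G = Path_Vertex ` {l..r}" by (simp add: induced_subgraph_def)
  have sym: "sym ((adjacency ?G)\<^sup>*)"
    by (intro sym_rtrancl symI) (simp add: adjacency_def insert_commute)
  have adj: "(Path_Vertex q, Path_Vertex (Suc q)) \<in> adjacency ?G" if "l \<le> q" "Suc q \<le> r" for q
  proof -
    have "q \<in> P" "Suc q \<in> P" using that assms by auto
    then have "{Path_Vertex q, Path_Vertex (Suc q)} \<in> edges (path_star_subgraph \<alpha> P S)"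
      unfolding edges_path_star_subgraph by blast
    then show ?thesis using that by (simp add: adjacency_def induced_subgraph_def)
  qed
  have reach: "(Path_Vertex l, Path_Vertex q) \<in> (adjacency ?G)\<^sup>*" if "l \<le> q" "q \<le> r" for q
    using that
  proof (induction q rule: dec_induct)
    case (step n)
    then show ?case using adj[of n] by (auto intro: rtrancl_into_rtrancl)
  qed simp
  have "(u, w) \<in> (adjacency ?G)\<^sup>*" if "u \<in> verts ?G" "w \<in> verts ?G" for u w
  proof -
    have "(Path_Vertex l, u) \<in> (adjacency ?G)\<^sup>*" "(Path_Vertex l, w) \<in> (adjacency ?G)\<^sup>*"
      using that reach unfolding v by auto
    then show ?thesis using sym by (blast intro: rtrancl_trans dest: symD)
  qed
  moreover have "verts ?G \<noteq> {}" using assms(1) unfolding v by simp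
  ultimately show ?thesis unfolding connected_graph_iff_rtrancl by blast
qed

lemma treewidth_ge_if_crossed:
  assumes "crossed \<alpha> P C k" "k \<le> card C" "finite P" "finite C"
  shows "k \<le> Suc (treewidth (path_star_subgraph \<alpha> P C))"
proof -
  obtain \<I> where I: "finite \<I>" "k \<le> card \<I>" "disjoint \<I>"
    "\<And>I. I \<in> \<I> \<Longrightarrow> I \<subseteq> P \<and> C \<subseteq> \<alpha> ` I \<and> (\<exists>l r. l \<le> r \<and> I = {l..r})"
    using assms(1) by (auto simp: crossed_def)
  have inj: "inj_on Path_Vertex A" "inj_on Star_Vertex A" for A by (auto simp: inj_on_def)
  let ?G = "path_star_subgraph \<alpha> P C"
  show ?thesis
  proof (rule treewidth_ge_bipartite_minor[where \<X> = "(`) Path_Vertex ` \<I>" and S = "Star_Vertex ` C"])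
    show "simple_graph ?G" by (rule simple_path_star_subgraph)
    show "finite (verts ?G)" using assms by (simp add: verts_path_star_subgraph)
    show "Star_Vertex ` C \<subseteq> verts ?G" by (simp add: verts_path_star_subgraph)
    show "k \<le> card (Star_Vertex ` C)" using assms(2) inj by (simp add: card_image)
    have "inj_on ((`) Path_Vertex) \<I>" by (intro inj_on_image inj)
    then show "k \<le> card ((`) Path_Vertex ` \<I>)" using I(2) by (simp add: card_image)
    show "disjoint ((`) Path_Vertex ` \<I>)"
      using I(3) unfolding disjoint_def by (auto simp: image_Int[OF inj(1), symmetric])
  next
    fix X assume "X \<in> (`) Path_Vertex ` \<I>"
    then obtain I where X: "X = Path_Vertex ` I" "I \<in> \<I>" by blast
    from I(4)[OF X(2)] obtain l r where lr: "l \<le> r" "I = {l..r}" "I \<subseteq> P" by blast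
    then have "connected_graph (induced_subgraph ?G X)"
      using connected_interval[of l r P \<alpha> C] by (simp add: X)
    moreover have "X \<subseteq> verts ?G" using lr(3) unfolding verts_path_star_subgraph X by blast
    ultimately show "X \<subseteq> verts ?G \<and> connected_graph (induced_subgraph ?G X)" by blast
    fix s assume "s \<in> Star_Vertex ` C"
    then obtain c where c: "c \<in> C" "s = Star_Vertex c" by blast
    have "c \<in> \<alpha> ` I" using I(4)[OF X(2)] c(1) by blast
    then obtain p where p: "p \<in> I" "c = \<alpha> p" by blast
    then have "p \<in> P" "\<alpha> p \<in> C" using c lr(3) by auto
    then have "{Path_Vertex p, s} \<in> edges ?G"
      unfolding edges_path_star_subgraph c(2) p(2) by blast
    moreover have "Path_Vertex p \<in> X" using p X by simp
    ultimately show "\<exists>x \<in> X. {x, s} \<in> edges ?G" by blast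
  qed
qed

section \<open>Nested words\<close>

text \<open>The branched structure of a nested word in a form that does not mention restricted words: \<open>base S\<close>
  is the base set of the word restricted to \<open>S\<close>, and the branches of \<open>S\<close> are the sets
  \<open>H i \<inter> (S - base S)\<close>. Two occurrences that are consecutive in the restricted word and carry
  no base letters carry neighbouring letters of one branch.\<close>

locale nested_word =
  fixes \<alpha> :: "nat \<Rightarrow> nat" and H :: "nat \<Rightarrow> nat set" and base :: "nat set \<Rightarrow> nat set" and b :: nat
  assumes disjoint_branches: "disjoint_family H"
    and base_subset: "base S \<subseteq> S"
    and finite_base: "finite (base S)"
    and card_base: "card (base S) \<le> b"
    and b_pos: "1 \<le> b"
    and in_branch: "S - base S \<subseteq> \<Union>(range H)"
    and consecutive: "p < q \<Longrightarrow> \<alpha> p \<in> S - base S \<Longrightarrow> \<alpha> q \<in> S - base S \<Longrightarrow>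
      (\<And>r. p < r \<Longrightarrow> r < q \<Longrightarrow> \<alpha> r \<notin> S) \<Longrightarrow>
      \<exists>i. \<alpha> p \<in> H i \<and> \<alpha> q \<in> H i \<and> \<alpha> p < \<alpha> q \<and>
        (\<forall>y \<in> H i \<inter> (S - base S). \<not> (\<alpha> p < y \<and> y < \<alpha> q))"

lemma enumerate_neighbours:
  assumes "p \<in> J" "q \<in> J" "p < q" "\<And>r. p < r \<Longrightarrow> r < q \<Longrightarrow> r \<notin> J" and "infinite (J :: nat set)"
  obtains n where "enumerate J n = p" "enumerate J (Suc n) = q"
proof -
  obtain n where n: "enumerate J n = p" using enumerate_Ex[OF assms(5,1)] by blast
  have "(LEAST s. s \<in> J \<and> p < s) = q"
    using assms(2-4) by (intro Least_equality) (auto simp: not_less[symmetric])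
  then have "enumerate J (Suc n) = q"
    using enumerate_Suc''[OF assms(5), of n] n by simp
  then show thesis using that n by blast
qed

text \<open>The letters that are absent from the word are collected in one additional branch, so that base sets
  are available for all sets of letters, not only for subsets of the alphabet. As each letter
  of the alphabet occurs infinitely often, the restriction to a nonempty set is again an infinite word.\<close>

lemma nested_imp_nested_word:
  assumes "nested \<alpha>"
  shows "\<exists>H base b. nested_word \<alpha> H base b"
proof -
  obtain b where b: "b \<ge> 1" "b_nested b \<alpha>" using assms by (auto simp: nested_def)
  then obtain A H where ex: "\<exists>B. branched (Infinite_Word \<alpha>) A B H"
    and inf: "\<forall>x \<in> A. infinite {j. \<alpha> j = x}"
    and sub: "\<forall>S \<subseteq> A. \<exists>B\<^sub>S H\<^sub>S. card B\<^sub>S \<le> b \<and>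
           branched (restrict_word (Infinite_Word \<alpha>) S) S B\<^sub>S H\<^sub>S \<and> (\<forall>i. H\<^sub>S i \<subseteq> H i)"
    unfolding b_nested_def by blast
  have ranA: "\<alpha> j \<in> A" for j using ex by (auto simp: branched_def)
  have HA: "H i \<subseteq> A" for i using ex by (auto simp: branched_def)
  have disjH: "disjoint_family H" using ex by (auto simp: branched_def)
  define H' where "H' i = (case i of 0 \<Rightarrow> - A | Suc i \<Rightarrow> H i)" for i
  define good where "good S B \<longleftrightarrow> B \<subseteq> S \<and> finite B \<and> card B \<le> b \<and> S - B \<subseteq> \<Union>(range H') \<and>
    (\<forall>p q. p < q \<longrightarrow> \<alpha> p \<in> S - B \<longrightarrow> \<alpha> q \<in> S - B \<longrightarrow> (\<forall>r. p < r \<longrightarrow> r < q \<longrightarrow> \<alpha> r \<notin> S) \<longrightarrow>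
      (\<exists>i. \<alpha> p \<in> H' i \<and> \<alpha> q \<in> H' i \<and> \<alpha> p < \<alpha> q \<and>
        (\<forall>y \<in> H' i \<inter> (S - B). \<not> (\<alpha> p < y \<and> y < \<alpha> q))))" for S B
  have "\<exists>B. good S B" for S
  proof -
    have "S \<inter> A \<subseteq> A" by simp
    then obtain B HS where cB: "card B \<le> b"
      and br: "branched (restrict_word (Infinite_Word \<alpha>) (S \<inter> A)) (S \<inter> A) B HS"
      and HS: "\<And>i. HS i \<subseteq> H i"
      using sub by meson
    have B: "finite B" "S \<inter> A = B \<union> (\<Union>i. HS i)" "B \<inter> (\<Union>i. HS i) = {}"
      using br unfolding branched_def by blast+
    define w where "w = restrict_word (Infinite_Word \<alpha>) (S \<inter> A)"
    have after: "if \<forall>y \<in> HS i. x \<le> y then j = 0 \<or> (\<exists>b \<in> B. letter_at w (j - 1) = Some b)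
         else j > 0 \<and> letter_at w (j - 1) = Some (Max {y \<in> HS i. y < x})"
      if "x \<in> HS i" "letter_at w j = Some x" for i j x
      using br that unfolding branched_def w_def[symmetric] by blast
    have HSH: "H i \<inter> (S - B) \<subseteq> HS i" for i
    proof
      fix y assume y: "y \<in> H i \<inter> (S - B)"
      then have "y \<in> S \<inter> A" using HA by blast
      then obtain j where j: "y \<in> HS j" using B(2) y by blast
      then have "y \<in> H j" using HS by blast
      then have "i = j" using y disjH unfolding disjoint_family_on_def by blast
      then show "y \<in> HS i" using j by simp
    qed
    have cons: "\<exists>i. \<alpha> p \<in> H' i \<and> \<alpha> q \<in> H' i \<and> \<alpha> p < \<alpha> q \<and>
        (\<forall>y \<in> H' i \<inter> (S - B). \<not> (\<alpha> p < y \<and> y < \<alpha> q))"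
      if pq: "p < q" "\<alpha> p \<in> S - B" "\<alpha> q \<in> S - B" and none: "\<forall>r. p < r \<longrightarrow> r < q \<longrightarrow> \<alpha> r \<notin> S" for p q
    proof -
      define J where "J = {j. \<alpha> j \<in> S \<inter> A}"
      have "{j. \<alpha> j = \<alpha> p} \<subseteq> J" using pq ranA by (auto simp: J_def)
      then have J: "infinite J" using inf ranA finite_subset by blast
      obtain n where n: "enumerate J n = p" "enumerate J (Suc n) = q"
      proof (rule enumerate_neighbours[OF _ _ pq(1) _ J])
        show "p \<in> J" "q \<in> J" using pq ranA by (auto simp: J_def)
        show "r \<notin> J" if "p < r" "r < q" for r using none that by (auto simp: J_def)
      qed blast
      have word: "letter_at w m = Some (\<alpha> (enumerate J m))" for m
        using J unfolding w_def restrict_word.simps J_def[symmetric] Let_def by simp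
      have "\<alpha> q \<in> S \<inter> A" using pq ranA by blast
      then obtain i where i: "\<alpha> q \<in> HS i" using B(2) pq(3) by blast
      have af: "if \<forall>y \<in> HS i. \<alpha> q \<le> y then \<exists>b \<in> B. \<alpha> p = b else \<alpha> p = Max {y \<in> HS i. y < \<alpha> q}"
        using after[OF i, of "Suc n"] n by (auto simp: word split: if_splits)
      \<comment> \<open>the first letter of a branch would have to follow a base letter\<close>
      have nofirst: "\<not> (\<forall>y \<in> HS i. \<alpha> q \<le> y)"
      proof
        assume "\<forall>y \<in> HS i. \<alpha> q \<le> y"
        with af have "\<exists>b \<in> B. \<alpha> p = b" by (simp only: if_True)
        then show False using pq(2) by blast
      qed
      then have max: "\<alpha> p = Max {y \<in> HS i. y < \<alpha> q}" using af by (simp only: if_False)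
      have ne: "{y \<in> HS i. y < \<alpha> q} \<noteq> {}" using nofirst by (auto simp: not_le)
      have fin: "finite {y \<in> HS i. y < \<alpha> q}" by simp
      have p: "\<alpha> p \<in> HS i" "\<alpha> p < \<alpha> q" using Max_in[OF fin ne] unfolding max[symmetric] by auto
      have between: "\<not> (\<alpha> p < y \<and> y < \<alpha> q)" if "y \<in> HS i" for y
        using Max_ge[OF fin, of y] that unfolding max[symmetric] by auto
      show ?thesis
      proof (intro exI[of _ "Suc i"] conjI ballI)
        show "\<alpha> p \<in> H' (Suc i)" "\<alpha> q \<in> H' (Suc i)" using p i HS by (auto simp: H'_def)
        show "\<alpha> p < \<alpha> q" by fact
        show "\<not> (\<alpha> p < y \<and> y < \<alpha> q)" if "y \<in> H' (Suc i) \<inter> (S - B)" for y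
          using between[of y] that HSH[of i] by (auto simp: H'_def)
      qed
    qed
    have "S - B \<subseteq> \<Union>(range H')"
    proof
      fix x assume x: "x \<in> S - B"
      show "x \<in> \<Union>(range H')"
      proof (cases "x \<in> A")
        case False
        then have "x \<in> H' 0" by (simp add: H'_def)
        then show ?thesis by blast
      next
        case True
        then obtain i where "x \<in> HS i" using x B(2) by blast
        then have "x \<in> H' (Suc i)" using HS by (auto simp: H'_def)
        then show ?thesis by blast
      qed
    qed
    moreover have "B \<subseteq> S" using B(2) by blast
    ultimately have "good S B" unfolding good_def using B(1) cB cons by simp
    then show ?thesis by blast
  qed
  then obtain base where base: "\<And>S. good S (base S)" by metis
  have disj': "disjoint_family H'"
    unfolding disjoint_family_on_def
  proof (intro ballI impI)
    fix m n :: nat assume "m \<noteq> n"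
    then show "H' m \<inter> H' n = {}"
      using HA disjH by (cases m; cases n) (auto simp: H'_def disjoint_family_on_def)
  qed
  have "nested_word \<alpha> H' base b"
    using base b(1) disj' unfolding nested_word_def good_def by simp
  then show ?thesis by blast
qed

context nested_word
begin

lemma branch_unique: "x \<in> H i \<Longrightarrow> x \<in> H j \<Longrightarrow> i = j"
  using disjoint_branches unfolding disjoint_family_on_def by blast

text \<open>Each step from one occurrence of a letter of \<open>S\<close> to the next moves to the neighbouring letter of
  the same branch, and the branch cannot change on the way because branches are disjoint.\<close>

lemma stretch_without_base:
  assumes "p < q" "\<alpha> p \<in> S" "\<alpha> q \<in> S" "\<And>r. p \<le> r \<Longrightarrow> r \<le> q \<Longrightarrow> \<alpha> r \<notin> base S"
  shows "\<exists>i. \<alpha> p \<in> H i \<and> \<alpha> q \<in> H i \<and> \<alpha> p < \<alpha> q \<and>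
    (\<forall>y \<in> H i \<inter> (S - base S). \<alpha> p < y \<and> y < \<alpha> q \<longrightarrow> (\<exists>r. p < r \<and> r < q \<and> \<alpha> r = y))"
  using assms
proof (induction q rule: less_induct)
  case (less q)
  have pq: "\<alpha> p \<in> S - base S" "\<alpha> q \<in> S - base S" using less.prems by auto
  show ?case
  proof (cases "\<exists>r. p < r \<and> r < q \<and> \<alpha> r \<in> S")
    case False
    then have "\<exists>i. \<alpha> p \<in> H i \<and> \<alpha> q \<in> H i \<and> \<alpha> p < \<alpha> q \<and>
        (\<forall>y \<in> H i \<inter> (S - base S). \<not> (\<alpha> p < y \<and> y < \<alpha> q))"
      using consecutive[OF less.prems(1) pq] by blast
    then show ?thesis by blast
  next
    case True
    \<comment> \<open>the induction hypothesis covers \<open>p\<close> to \<open>m\<close>, and from \<open>m\<close> to \<open>q\<close> there is a single step\<close>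
    define m where "m = Max {r. p < r \<and> r < q \<and> \<alpha> r \<in> S}"
    have fin: "finite {r. p < r \<and> r < q \<and> \<alpha> r \<in> S}" by (rule finite_subset[of _ "{..q}"]) auto
    have m: "p < m" "m < q" "\<alpha> m \<in> S" using Max_in[OF fin] True unfolding m_def[symmetric] by auto
    have none: "\<alpha> r \<notin> S" if "m < r" "r < q" for r
      using Max_ge[OF fin, of r] that m(1) unfolding m_def[symmetric] by auto
    obtain i where i: "\<alpha> p \<in> H i" "\<alpha> m \<in> H i" "\<alpha> p < \<alpha> m"
      "\<And>y. y \<in> H i \<inter> (S - base S) \<Longrightarrow> \<alpha> p < y \<Longrightarrow> y < \<alpha> m \<Longrightarrow> \<exists>r. p < r \<and> r < m \<and> \<alpha> r = y"
      using less.IH[OF m(2) m(1) less.prems(2) m(3)] less.prems(4) m by force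
    have "\<alpha> m \<in> S - base S" using m less.prems(4)[of m] by auto
    then obtain j where j: "\<alpha> m \<in> H j" "\<alpha> q \<in> H j" "\<alpha> m < \<alpha> q"
      "\<And>y. y \<in> H j \<inter> (S - base S) \<Longrightarrow> \<not> (\<alpha> m < y \<and> y < \<alpha> q)"
      using consecutive[OF m(2) _ pq(2) none] by blast
    have ij: "j = i" using branch_unique i j by blast
    have "\<exists>r. p < r \<and> r < q \<and> \<alpha> r = y"
      if y: "y \<in> H i \<inter> (S - base S)" "\<alpha> p < y" "y < \<alpha> q" for y
    proof (cases y "\<alpha> m" rule: linorder_cases)
      case less
      then show ?thesis using i(4)[OF y(1,2)] m(2) by (meson less_trans)
    next
      case equal
      then show ?thesis using m by blast
    next
      case greater
      then show ?thesis using j(4) y ij by blast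
    qed
    then show ?thesis using i(1,3) j(2,3) ij by (metis less_trans)
  qed
qed

text \<open>Peeling off base sets: the layers are disjoint, have at most \<open>b\<close> letters each, and two occurrences
  of letters of \<open>level S k\<close> are separated by a letter of each layer below \<open>k\<close> unless they belong to
  one branch.\<close>

fun level :: "nat set \<Rightarrow> nat \<Rightarrow> nat set" where
  "level S 0 = S"
| "level S (Suc j) = level S j - base (level S j)"

definition layer :: "nat set \<Rightarrow> nat \<Rightarrow> nat set" where
  "layer S j = base (level S j)"

lemma level_antimono: "j \<le> k \<Longrightarrow> level S k \<subseteq> level S j"
  by (induction k rule: dec_induct) auto

lemma layer_subset_level: "layer S j \<subseteq> level S j"
  by (simp add: layer_def base_subset)

lemma level_disjoint_layer: "j < k \<Longrightarrow> level S k \<inter> layer S j = {}"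
  using level_antimono[of "Suc j" k S] by (auto simp: layer_def)

lemma layers_disjoint: "x \<in> layer S j \<Longrightarrow> x \<in> layer S k \<Longrightarrow> j = k"
  using level_disjoint_layer[of j k S] level_disjoint_layer[of k j S] layer_subset_level
  by (metis disjoint_iff linorder_neqE_nat subsetD)

lemma level_eq: "level S t = S - (\<Union>j<t. layer S j)"
  by (induction t) (auto simp: layer_def lessThan_Suc)

lemma finite_layer: "finite (layer S j)" and card_layer: "card (layer S j) \<le> b"
  by (simp_all add: layer_def finite_base card_base)

lemma level_in_branch: "0 < t \<Longrightarrow> level S t \<subseteq> \<Union>(range H)"
  using level_antimono[of "Suc 0" t S] in_branch[of S] by auto

text \<open>Letters are classified by their rank in their branch modulo \<open>g + 1\<close>. The largest class has the
  required size, and ranks that differ by a multiple of \<open>g + 1\<close> leave \<open>g\<close> letters in between.\<close>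

lemma thin_branches:
  assumes "finite C"
  shows "\<exists>C' \<subseteq> C. card C \<le> card C' * Suc g \<and>
    (\<forall>i. \<forall>x \<in> C' \<inter> H i. \<forall>y \<in> C' \<inter> H i. x < y \<longrightarrow> g \<le> card {z \<in> C \<inter> H i. x < z \<and> z < y})"
proof (cases "C = {}")
  case False
  define f where "f x = card {z \<in> C. (\<exists>i. x \<in> H i \<and> z \<in> H i) \<and> z < x} mod Suc g" for x
  have "\<exists>y \<in> {..g}. card C \<le> card (f -` {y} \<inter> C) * card {..g}"
  proof (rule pigeonhole_card)
    show "f \<in> C \<rightarrow> {..g}" by (auto simp: f_def less_Suc_eq_le[symmetric])
  qed (use assms in auto)
  then obtain c where "card C \<le> card (f -` {c} \<inter> C) * card {..g}" by blast
  then have c: "card C \<le> card (f -` {c} \<inter> C) * Suc g" unfolding card_atMost .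
  let ?C = "f -` {c} \<inter> C"
  have "g \<le> card {z \<in> C \<inter> H i. x < z \<and> z < y}" if xy: "x \<in> ?C \<inter> H i" "y \<in> ?C \<inter> H i" "x < y" for i x y
  proof -
    let ?R = "\<lambda>x. {z \<in> C \<inter> H i. z < x}" and ?M = "{z \<in> C \<inter> H i. x < z \<and> z < y}"
    have R: "{z \<in> C. (\<exists>i. x \<in> H i \<and> z \<in> H i) \<and> z < x} = ?R x" if "x \<in> H i" for x
    proof -
      have "(\<exists>j. x \<in> H j \<and> z \<in> H j) \<longleftrightarrow> z \<in> H i" for z
        using that branch_unique[of x i] by blast
      then show ?thesis by auto
    qed
    have "f x = f y" using xy by auto
    then have mod: "card (?R x) mod Suc g = card (?R y) mod Suc g"
      using R xy by (simp add: f_def)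
    have "?R y = ?R x \<union> insert x ?M" using xy by auto
    moreover have "card (?R x \<union> insert x ?M) = card (?R x) + card (insert x ?M)"
      using assms by (intro card_Un_disjoint) auto
    moreover have "card (insert x ?M) = Suc (card ?M)" using assms by (intro card_insert_disjoint) auto
    ultimately have "card (?R y) = card (?R x) + Suc (card ?M)" by simp
    moreover from this have "Suc g dvd card (?R y) - card (?R x)"
      using mod mod_eq_dvd_iff_nat[of "card (?R x)" "card (?R y)" "Suc g"] by simp
    ultimately have "Suc g dvd Suc (card ?M)" by simp
    then show ?thesis by (meson Suc_le_mono dvd_imp_le zero_less_Suc)
  qed
  then show ?thesis using c by (intro exI[of _ ?C]) blast
qed simp

text \<open>The distance is measured in the whole word, including the positions whose letters are not in \<open>C\<close>.
  It is therefore a lower bound for the length of paths between star vertices, and cycles through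
  spread stars are long.\<close>

definition spread :: "nat \<Rightarrow> nat set \<Rightarrow> bool" where
  "spread g C \<longleftrightarrow> (\<forall>p q. p < q \<longrightarrow> \<alpha> p \<in> C \<longrightarrow> \<alpha> q \<in> C \<longrightarrow> p + g < q)"

text \<open>Consider two occurrences of letters of \<open>C'\<close>. Either each of the first \<open>g\<close> layers has a letter
  between them, which gives \<open>g\<close> intermediate positions, or they lie in a stretch without base letters
  of some \<open>level S j\<close>. In the latter case all letters of \<open>C\<close> between them in their branch occur
  on the way, and there are \<open>g\<close> of those by thinness.\<close>

lemma spread_if_thin:
  assumes C: "C \<subseteq> level S g" "C' \<subseteq> C" "finite C"
    and thin: "\<And>i x y. x \<in> C' \<inter> H i \<Longrightarrow> y \<in> C' \<inter> H i \<Longrightarrow> x < y \<Longrightarrow>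
      g \<le> card {z \<in> C \<inter> H i. x < z \<and> z < y}"
  shows "spread g C'"
  unfolding spread_def
proof (intro allI impI)
  fix p q assume pq: "p < q" "\<alpha> p \<in> C'" "\<alpha> q \<in> C'"
  have fin: "finite {p<..<q}" by simp
  have "g \<le> card {p<..<q}"
  proof (cases "\<forall>j<g. \<exists>r. p < r \<and> r < q \<and> \<alpha> r \<in> layer S j")
    case True
    then obtain f where f: "\<And>j. j < g \<Longrightarrow> p < f j \<and> f j < q \<and> \<alpha> (f j) \<in> layer S j" by metis
    have "inj_on f {..<g}"
    proof (rule inj_onI)
      fix j k assume "j \<in> {..<g}" "k \<in> {..<g}" "f j = f k"
      then show "j = k" using f[of j] f[of k] layers_disjoint by auto
    qed
    moreover have "f ` {..<g} \<subseteq> {p<..<q}" using f by auto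
    ultimately have "card {..<g} \<le> card {p<..<q}" using card_inj_on_le fin by blast
    then show ?thesis by simp
  next
    case False
    then obtain j where j: "j < g" and none: "\<And>r. p < r \<Longrightarrow> r < q \<Longrightarrow> \<alpha> r \<notin> layer S j" by blast
    have CS: "C \<subseteq> level S j - base (level S j)" using C(1) level_antimono[of "Suc j" g S] j by auto
    have "\<exists>i. \<alpha> p \<in> H i \<and> \<alpha> q \<in> H i \<and> \<alpha> p < \<alpha> q \<and>
      (\<forall>y \<in> H i \<inter> (level S j - base (level S j)). \<alpha> p < y \<and> y < \<alpha> q \<longrightarrow> (\<exists>r. p < r \<and> r < q \<and> \<alpha> r = y))"
    proof (rule stretch_without_base[OF pq(1)])
      show "\<alpha> p \<in> level S j" "\<alpha> q \<in> level S j" using pq CS C(2) by blast+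
      show "\<alpha> r \<notin> base (level S j)" if "p \<le> r" "r \<le> q" for r
        using none[of r] that pq CS C(2) unfolding layer_def by (metis DiffE le_neq_implies_less subsetD)
    qed
    then obtain i where i: "\<alpha> p \<in> H i" "\<alpha> q \<in> H i" "\<alpha> p < \<alpha> q"
      and ex: "\<And>y. y \<in> H i \<inter> (level S j - base (level S j)) \<Longrightarrow> \<alpha> p < y \<Longrightarrow> y < \<alpha> q \<Longrightarrow>
        \<exists>r. p < r \<and> r < q \<and> \<alpha> r = y" by blast
    have "g \<le> card {z \<in> C \<inter> H i. \<alpha> p < z \<and> z < \<alpha> q}" using thin i pq by blast
    also have "\<dots> \<le> card (\<alpha> ` {p<..<q})"
    proof (rule card_mono)
      show "{z \<in> C \<inter> H i. \<alpha> p < z \<and> z < \<alpha> q} \<subseteq> \<alpha> ` {p<..<q}"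
      proof
        fix z assume "z \<in> {z \<in> C \<inter> H i. \<alpha> p < z \<and> z < \<alpha> q}"
        then obtain r where "p < r" "r < q" "\<alpha> r = z" using ex[of z] CS by blast
        then show "z \<in> \<alpha> ` {p<..<q}" by auto
      qed
    qed simp
    also have "\<dots> \<le> card {p<..<q}" by (rule card_image_le) simp
    finally show ?thesis .
  qed
  then show "p + g < q" using pq(1) by simp
qed

end

section \<open>Disjoint intervals and hitting sets\<close>

text \<open>Greedily choose an interval with property \<open>R\<close> that ends as early as possible and put its end into
  the hitting set. An interval with property \<open>R\<close> avoiding this end has to start after it. The bound \<open>m\<close> confines
  the remaining choices to the part of \<open>P\<close> behind that end.\<close>

lemma disjoint_intervals_or_hitting_set_above:
  assumes "finite (P :: nat set)"
  shows "(\<exists>\<I>. finite \<I> \<and> card \<I> = N \<and> disjoint \<I> \<and>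
        (\<forall>I \<in> \<I>. I \<subseteq> P \<inter> {m..} \<and> R I \<and> (\<exists>l r. l \<le> r \<and> I = {l..r}))) \<or>
    (\<exists>Z \<subseteq> P. card Z \<le> N \<and> (\<forall>l r. m \<le> l \<longrightarrow> l \<le> r \<longrightarrow> {l..r} \<subseteq> P - Z \<longrightarrow> \<not> R {l..r}))"
proof (induction N arbitrary: m)
  case 0
  show ?case by (intro disjI1 exI[of _ "{}"]) (simp add: disjoint_def)
next
  case (Suc N)
  define ends where "ends r \<longleftrightarrow> (\<exists>l. m \<le> l \<and> l \<le> r \<and> {l..r} \<subseteq> P \<and> R {l..r})" for r
  show ?case
  proof (cases "\<exists>r. ends r")
    case False
    then show ?thesis by (intro disjI2 exI[of _ "{}"]) (auto simp: ends_def)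
  next
    case True
    define r where "r = (LEAST r. ends r)"
    have "ends r" using True unfolding r_def by (rule LeastI_ex)
    then obtain l where l: "m \<le> l" "l \<le> r" "{l..r} \<subseteq> P" "R {l..r}" unfolding ends_def by blast
    have least: "r \<le> r'" if "ends r'" for r' using that unfolding r_def by (rule Least_le)
    have "r \<in> P" using l by auto
    show ?thesis
      using Suc.IH[of "Suc r"]
    proof (elim disjE exE conjE)
      fix \<I> assume I: "finite \<I>" "card \<I> = N" "disjoint \<I>"
        "\<forall>I \<in> \<I>. I \<subseteq> P \<inter> {Suc r..} \<and> R I \<and> (\<exists>l r. l \<le> r \<and> I = {l..r})"
      have away: "I \<inter> {l..r} = {}" if "I \<in> \<I>" for I using I(4) that by fastforce
      have "{l..r} \<notin> \<I>" using away[of "{l..r}"] l(2) by auto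
      then have card: "card (insert {l..r} \<I>) = Suc N" using I by simp
      have disj: "disjoint (insert {l..r} \<I>)"
        using I(3) away unfolding disjoint_def by blast
      have each: "I \<subseteq> P \<inter> {m..} \<and> R I \<and> (\<exists>l r. l \<le> r \<and> I = {l..r})"
        if "I \<in> insert {l..r} \<I>" for I
      proof (cases "I = {l..r}")
        case True
        have "{l..r} \<subseteq> P \<inter> {m..}" using l by auto
        then show ?thesis using True l(2,4) by blast
      next
        case False
        then have "I \<in> \<I>" using that by blast
        with I(4) have "I \<subseteq> P \<inter> {Suc r..} \<and> R I \<and> (\<exists>l r. l \<le> r \<and> I = {l..r})" by (rule bspec)
        moreover have "{Suc r..} \<subseteq> {m..}" using l by auto
        ultimately show ?thesis by auto
      qed
      have "finite (insert {l..r} \<I>)" using I(1) by simp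
      then show ?thesis
        using card disj each by (intro disjI1 exI[of _ "insert {l..r} \<I>"]) simp
    next
      fix Z assume Z: "Z \<subseteq> P" "card Z \<le> N"
        "\<forall>l r'. Suc r \<le> l \<longrightarrow> l \<le> r' \<longrightarrow> {l..r'} \<subseteq> P - Z \<longrightarrow> \<not> R {l..r'}"
      have "\<not> R {l'..r'}" if "m \<le> l'" "l' \<le> r'" "{l'..r'} \<subseteq> P - insert r Z" for l' r'
      proof
        assume R: "R {l'..r'}"
        then have "r \<le> r'" using that R by (intro least) (auto simp: ends_def)
        moreover have "r \<notin> {l'..r'}" using that(3) by blast
        ultimately have "Suc r \<le> l'" by auto
        then show False using Z(3) that R by blast
      qed
      moreover have "card (insert r Z) \<le> Suc N"
        using Z(1,2) finite_subset[OF Z(1) assms] by (simp add: card_insert_if)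
      ultimately show ?thesis
        using Z(1) \<open>r \<in> P\<close> by (intro disjI2 exI[of _ "insert r Z"]) simp
    qed
  qed
qed

lemma disjoint_intervals_or_hitting_set:
  assumes "finite (P :: nat set)"
  shows "(\<exists>\<I>. finite \<I> \<and> card \<I> = N \<and> disjoint \<I> \<and>
        (\<forall>I \<in> \<I>. I \<subseteq> P \<and> R I \<and> (\<exists>l r. l \<le> r \<and> I = {l..r}))) \<or>
    (\<exists>Z \<subseteq> P. card Z \<le> N \<and> (\<forall>l r. l \<le> r \<longrightarrow> {l..r} \<subseteq> P - Z \<longrightarrow> \<not> R {l..r}))"
  using disjoint_intervals_or_hitting_set_above[OF assms, of N 0 R] by simp

section \<open>Hanging paths on a tree decomposition\<close>

text \<open>A stretch of consecutive path vertices whose outside neighbours all lie in one bag \<open>Y\<close> is hung on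
  \<open>Y\<close> as a path of bags, each of which consists of \<open>Y\<close> and two consecutive vertices of the stretch.
  The assumption \<open>const\<close> says that \<open>Y\<close> is the same along each stretch. For \<open>p = 0\<close> the truncated \<open>p - 1\<close> is \<open>p\<close> itself,
  so that this bag gets a single vertex of the stretch.\<close>

lemma tree_bags_attach_paths:
  fixes Y :: "nat \<Rightarrow> ps_vertex set"
  assumes Bs: "tree_bags k Bs" and Q: "finite Q"
    and Y: "\<And>p. p \<in> Q \<Longrightarrow> Y p \<in> Bs" "\<And>p. p \<in> Q \<Longrightarrow> card (Y p) + 2 \<le> k"
    and fresh: "\<And>p. p \<in> Q \<Longrightarrow> Path_Vertex p \<notin> \<Union>Bs"
    and const: "\<And>p. p \<in> Q \<Longrightarrow> Suc p \<in> Q \<Longrightarrow> Y (Suc p) = Y p"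
  shows "tree_bags k (Bs \<union> (\<lambda>p. Y p \<union> Path_Vertex ` ({p - 1, p} \<inter> Q)) ` Q)"
proof -
  define bag where "bag p = Y p \<union> Path_Vertex ` ({p - 1, p} \<inter> Q)" for p
  have card: "card (bag p) \<le> k" "finite (bag p)" if p: "p \<in> Q" for p
  proof -
    have "card (Path_Vertex ` ({p - 1, p} \<inter> Q)) \<le> card ({p - 1, p} \<inter> Q)" by (rule card_image_le) simp
    also have "\<dots> \<le> card {p - 1, p}" by (rule card_mono) auto
    also have "\<dots> \<le> 2" by (simp add: card_insert_if)
    finally show "card (bag p) \<le> k"
      using card_Un_le[of "Y p" "Path_Vertex ` ({p - 1, p} \<inter> Q)"] Y(2)[OF p] unfolding bag_def by linarith
    show "finite (bag p)" using tree_bags_bounds[OF Bs] Y(1)[OF p] by (simp add: bag_def)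
  qed
  have "tree_bags k (Bs \<union> bag ` (Q \<inter> {..<m}))" for m
  proof (induction m)
    case 0
    then show ?case using Bs by simp
  next
    case (Suc m)
    let ?Bs = "Bs \<union> bag ` (Q \<inter> {..<m})"
    show ?case
    proof (cases "m \<in> Q")
      case False
      then have "Q \<inter> {..<Suc m} = Q \<inter> {..<m}" by (auto simp: less_Suc_eq)
      then show ?thesis using Suc by simp
    next
      case True
      have eq: "Bs \<union> bag ` (Q \<inter> {..<Suc m}) = insert (bag m) ?Bs"
        using True by (auto simp: lessThan_Suc)
      have new: "Path_Vertex m \<notin> \<Union>?Bs"
      proof
        assume "Path_Vertex m \<in> \<Union>?Bs"
        then obtain p where p: "p \<in> Q" "p < m" "Path_Vertex m \<in> bag p" using fresh[OF True] by auto
        then have "Path_Vertex m \<in> Y p" by (auto simp: bag_def)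
        then show False using Y(1)[OF p(1)] fresh[OF True] by blast
      qed
      define Z where "Z = (if m - 1 \<in> Q \<and> 0 < m then bag (m - 1) else Y m)"
      have Z: "Z \<in> ?Bs" using Y(1)[OF True] by (auto simp: Z_def)
      have sub: "bag m - {Path_Vertex m} \<subseteq> Z"
      proof (cases "m - 1 \<in> Q \<and> 0 < m")
        case True
        then have "Y m = Y (m - 1)" using const[of "m - 1"] \<open>m \<in> Q\<close> by simp
        then show ?thesis using True by (auto simp: Z_def bag_def)
      next
        case False
        then show ?thesis by (auto simp: Z_def bag_def)
      qed
      have "bag m \<inter> \<Union>?Bs \<subseteq> Z"
      proof
        fix v assume v: "v \<in> bag m \<inter> \<Union>?Bs"
        have "v \<noteq> Path_Vertex m"
        proof
          assume "v = Path_Vertex m"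
          then show False using v new by simp
        qed
        then show "v \<in> Z" using sub v by auto
      qed
      then have "tree_bags k (insert (bag m) ?Bs)"
        by (rule tree_bags.attach[OF Suc Z card(2)[OF True] card(1)[OF True]])
      then show ?thesis using eq by simp
    qed
  qed
  note bags = this
  obtain m where "Q \<subseteq> {..<m}" using Q unfolding finite_nat_iff_bounded ..
  then have "Q \<inter> {..<m} = Q" by (rule Int_absorb2)
  then show ?thesis using bags[of m] unfolding bag_def by simp
qed

section \<open>Path-star graphs whose path pieces spell consecutive letters\<close>

text \<open>A path-star graph whose path falls into pieces, each spelling consecutive letters: \<open>idx\<close> numbers
  the letters of \<open>C\<close>, and along a piece the numbers of the letters met go up in steps of one. A
  window of \<open>t\<close> consecutive letters can still be crossed by several pieces, but by fewer than
  \<open>M\<close> of them. Sweeping over the windows then gives a tree-decomposition of width bounded in terms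
  of \<open>t\<close> and \<open>M\<close>.\<close>

locale consecutive_path_star =
  fixes \<alpha> :: "nat \<Rightarrow> nat" and P C :: "nat set" and idx :: "nat \<Rightarrow> nat" and t M :: nat
  assumes finite_P: "finite P" and finite_C: "finite C" and inj_idx: "inj_on idx C"
    and t_pos: "0 < t"
    and successor: "\<And>p q. p < q \<Longrightarrow> {p..q} \<subseteq> P \<Longrightarrow> \<alpha> p \<in> C \<Longrightarrow> \<alpha> q \<in> C \<Longrightarrow>
      (\<And>r. p < r \<Longrightarrow> r < q \<Longrightarrow> \<alpha> r \<notin> C) \<Longrightarrow> idx (\<alpha> q) = Suc (idx (\<alpha> p))"
    and not_crossed: "\<And>D. D \<subseteq> C \<Longrightarrow> card D = t \<Longrightarrow> \<not> crossed \<alpha> P D M"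
begin

definition num :: "nat \<Rightarrow> nat" where "num p = idx (\<alpha> p)"

definition lettered :: "nat set" where "lettered = {p \<in> P. \<alpha> p \<in> C}"

definition joined :: "nat \<Rightarrow> nat \<Rightarrow> bool" where
  "joined p q \<longleftrightarrow> {min p q..max p q} \<subseteq> P"

lemma joined_sym: "joined p q \<longleftrightarrow> joined q p"
  by (simp add: joined_def min.commute max.commute)

lemma joined_trans:
  assumes "joined p q" "joined q r" shows "joined p r"
proof -
  have "{min p r..max p r} \<subseteq> {min p q..max p q} \<union> {min q r..max q r}"
    by (auto simp: min_def max_def split: if_splits)
  then show ?thesis using assms unfolding joined_def by blast
qed

lemma joined_le: "p \<le> q \<Longrightarrow> joined p q \<longleftrightarrow> {p..q} \<subseteq> P"
  by (simp add: joined_def min_def max_def)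

lemma joined_between: "joined p q \<Longrightarrow> p \<le> r \<Longrightarrow> r \<le> q \<Longrightarrow> joined p r"
  by (auto simp: joined_def min_def max_def split: if_splits)

text \<open>Between two letter positions of a piece without a third one the number goes up by exactly one; the
  induction splits off the last such step.\<close>

lemma num_stretch:
  assumes "p < q" "joined p q" "p \<in> lettered" "q \<in> lettered"
  shows "num p < num q \<and> {num p..num q} \<subseteq> num ` (lettered \<inter> {p..q})"
  using assms
proof (induction q rule: less_induct)
  case (less q)
  have PQ: "{p..q} \<subseteq> P" using less.prems joined_le[of p q] by simp
  show ?case
  proof (cases "\<exists>r. p < r \<and> r < q \<and> r \<in> lettered")
    case False
    have "num q = Suc (num p)"
      unfolding num_def
    proof (rule successor[OF less.prems(1) PQ])
      fix r assume r: "p < r" "r < q"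
      then have "r \<in> P" using PQ by auto
      then show "\<alpha> r \<notin> C" using False r by (auto simp: lettered_def)
    qed (use less.prems in \<open>auto simp: lettered_def\<close>)
    then have "{num p..num q} \<subseteq> num ` {p, q}" by auto
    also have "\<dots> \<subseteq> num ` (lettered \<inter> {p..q})" using less.prems by (intro image_mono) auto
    finally show ?thesis using \<open>num q = Suc (num p)\<close> by simp
  next
    case True
    define m where "m = Max {r. p < r \<and> r < q \<and> r \<in> lettered}"
    have fin: "finite {r. p < r \<and> r < q \<and> r \<in> lettered}" by (rule finite_subset[of _ "{..q}"]) auto
    have m: "p < m" "m < q" "m \<in> lettered" using Max_in[OF fin] True unfolding m_def[symmetric] by auto
    have none: "r \<notin> lettered" if "m < r" "r < q" for r
      using Max_ge[OF fin, of r] that m(1) unfolding m_def[symmetric] by auto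
    have "joined p m" using joined_between[OF less.prems(2)] m by simp
    then have IH: "num p < num m" "{num p..num m} \<subseteq> num ` (lettered \<inter> {p..m})"
      using less.IH[OF m(2,1) _ less.prems(3) m(3)] by auto
    have "num q = Suc (num m)"
      unfolding num_def
    proof (rule successor[OF m(2)])
      show "{m..q} \<subseteq> P" using PQ m(1) by (auto simp: subset_iff)
      fix r assume r: "m < r" "r < q"
      then have "r \<in> P" using PQ m by auto
      then show "\<alpha> r \<notin> C" using none[OF r] by (auto simp: lettered_def)
    qed (use less.prems m in \<open>auto simp: lettered_def\<close>)
    moreover have "{num p..num q} \<subseteq> insert (num q) {num p..num m}" using \<open>num q = Suc (num m)\<close> by auto
    moreover have "num ` (lettered \<inter> {p..m}) \<subseteq> num ` (lettered \<inter> {p..q})" using m by (intro image_mono) auto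
    moreover have "num q \<in> num ` (lettered \<inter> {p..q})" using less.prems by (intro imageI) auto
    ultimately show ?thesis using IH by (intro conjI) (linarith, blast)
  qed
qed

lemma num_stretch_le:
  assumes "p \<le> q" "joined p q" "p \<in> lettered" "q \<in> lettered"
  shows "num p \<le> num q" "{num p..num q} \<subseteq> num ` (lettered \<inter> {p..q})"
  using num_stretch[of p q] assms by (cases "p = q"; auto)+

lemma num_inj_joined: "joined p q \<Longrightarrow> p \<in> lettered \<Longrightarrow> q \<in> lettered \<Longrightarrow> num p = num q \<Longrightarrow> p = q"
  using num_stretch[of p q] num_stretch[of q p] joined_sym[of p q] by (cases p q rule: linorder_cases) auto

text \<open>The piece of \<open>p\<close> covers a window of \<open>t\<close> consecutive letters.\<close>

definition long :: "nat \<Rightarrow> bool" where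
  "long p \<longleftrightarrow> (\<exists>u v. u \<le> v \<and> joined u v \<and> joined u p \<and> u \<in> lettered \<and> v \<in> lettered \<and>
     num u + t \<le> Suc (num v))"

text \<open>Only the letter positions of long pieces enter the bags of the sweep; the other path vertices are
  hung on afterwards.\<close>

definition anchors :: "nat \<Rightarrow> nat set" where
  "anchors x = {p \<in> lettered. long p \<and> num p = x}"

lemma long_joined: "joined p q \<Longrightarrow> long p \<Longrightarrow> long q"
  unfolding long_def using joined_trans by blast

text \<open>A window of \<open>t\<close> numbers containing \<open>x\<close> fits into the range of numbers met by the piece of
  \<open>p\<close>, because that range contains \<open>x\<close> and has at least \<open>t\<close> elements.\<close>

lemma anchor_window:
  assumes "p \<in> anchors x"
  shows "\<exists>a l r. a \<le> x \<and> x < a + t \<and> l \<le> p \<and> p \<le> r \<and> {l..r} \<subseteq> P \<and> {a..<a + t} \<subseteq> num ` (lettered \<inter> {l..r})"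
proof -
  have p: "p \<in> lettered" "long p" "num p = x" using assms by (auto simp: anchors_def)
  then obtain u v where uv: "u \<le> v" "joined u v" "joined u p" "u \<in> lettered" "v \<in> lettered"
    "num u + t \<le> Suc (num v)" unfolding long_def by blast
  have vp: "joined v p" using uv joined_trans joined_sym by blast
  have low: "\<exists>l. l \<le> p \<and> l \<le> u \<and> l \<in> lettered \<and> joined l p \<and> joined l v \<and> num l \<le> num u \<and> num l \<le> x"
  proof (cases "u \<le> p")
    case True
    then show ?thesis using uv p num_stretch_le(1)[of u p] by blast
  next
    case False
    have "joined p u" "joined p v" "joined p p" using uv vp joined_sym joined_trans by blast+
    then show ?thesis using False uv p num_stretch_le(1)[of p u] by (intro exI[of _ p]) auto
  qed
  then obtain l where l: "l \<le> p" "l \<le> u" "l \<in> lettered" "joined l p" "joined l v" "num l \<le> num u" "num l \<le> x"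
    by blast
  have "\<exists>r. p \<le> r \<and> r \<in> lettered \<and> joined l r \<and> num v \<le> num r \<and> x \<le> num r"
  proof (cases "v \<le> p")
    case True
    then show ?thesis using vp l p uv num_stretch_le(1)[of v p] by blast
  next
    case False
    have "joined p v" using vp joined_sym by blast
    then show ?thesis using False l uv p num_stretch_le(1)[of p v] by (intro exI[of _ v]) auto
  qed
  then obtain r where r: "p \<le> r" "r \<in> lettered" "joined l r" "num v \<le> num r" "x \<le> num r" by blast
  \<comment> \<open>the window starts at the least number of the piece if \<open>x\<close> is close to it, otherwise it ends at \<open>x\<close>\<close>
  define a where "a = (if num l + t \<le> x + 1 then x + 1 - t else num l)"
  have a: "a \<le> x" "x < a + t" "num l \<le> a" "a + t \<le> Suc (num r)"
    using l r uv(6) t_pos by (auto simp: a_def)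
  have "{a..<a + t} \<subseteq> {num l..num r}" using a by auto
  also have "\<dots> \<subseteq> num ` (lettered \<inter> {l..r})" using num_stretch_le(2)[of l r] l r by auto
  finally show ?thesis using a l r joined_le[of l r] by (metis order_trans)
qed

lemma finite_anchors: "finite (anchors x)"
  by (rule finite_subset[OF _ finite_P]) (auto simp: anchors_def lettered_def)

text \<open>Each anchor chooses one of at most \<open>t\<close> windows around \<open>x\<close>. Anchors with the same window lie
  in distinct pieces, since a piece meets the number \<open>x\<close> only once, and all these pieces cross
  that window.\<close>

lemma card_anchors: "card (anchors x) \<le> t * M"
proof (rule ccontr)
  assume many: "\<not> card (anchors x) \<le> t * M"
  have "\<forall>p \<in> anchors x. \<exists>a l r. a \<le> x \<and> x < a + t \<and> l \<le> p \<and> p \<le> r \<and> {l..r} \<subseteq> P \<and>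
      {a..<a + t} \<subseteq> num ` (lettered \<inter> {l..r})"
    using anchor_window by blast
  then obtain a l r where w: "\<And>p. p \<in> anchors x \<Longrightarrow> a p \<le> x \<and> x < a p + t \<and> l p \<le> p \<and> p \<le> r p \<and>
      {l p..r p} \<subseteq> P \<and> {a p..<a p + t} \<subseteq> num ` (lettered \<inter> {l p..r p})"
    by metis
  \<comment> \<open>the possible left ends of windows of size \<open>t\<close> around \<open>x\<close>\<close>
  let ?W = "{Suc x - t..x}"
  have "\<exists>y \<in> ?W. card (anchors x) \<le> card (a -` {y} \<inter> anchors x) * card ?W"
  proof (rule pigeonhole_card)
    show "a \<in> anchors x \<rightarrow> ?W" using w by fastforce
  qed (use finite_anchors t_pos in auto)
  then obtain y where y: "card (anchors x) \<le> card (a -` {y} \<inter> anchors x) * card ?W" by blast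
  let ?F = "a -` {y} \<inter> anchors x"
  have "card ?W \<le> t" by simp
  then have "card (anchors x) \<le> card ?F * t" by (rule order_trans[OF y mult_le_mono2])
  then have "t * M < t * card ?F" using many by (simp only: mult.commute[of "card ?F"] not_le)
  then have M: "M \<le> card ?F" by simp
  have same: "p = q" if p: "p \<in> ?F" and q: "q \<in> ?F" and ne: "{l p..r p} \<inter> {l q..r q} \<noteq> {}" for p q
  proof -
    obtain z where z: "z \<in> {l p..r p}" "z \<in> {l q..r q}" using ne by blast
    have "joined p z" "joined z q"
      using w[of p] w[of q] p q z by (auto simp: joined_def min_def max_def subset_iff)
    then have "joined p q" by (rule joined_trans)
    then show "p = q" using num_inj_joined p q by (auto simp: anchors_def)
  qed
  have ne: "l p \<le> r p" if "p \<in> ?F" for p using w[of p] that by auto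
  define D where "D = {c \<in> C. idx c \<in> {y..<y + t}}"
  have D: "D \<subseteq> \<alpha> ` {l p..r p}" and img: "idx ` D = {y..<y + t}" if p: "p \<in> ?F" for p
  proof -
    have win: "{y..<y + t} \<subseteq> num ` (lettered \<inter> {l p..r p})" using w[of p] p by auto
    show "D \<subseteq> \<alpha> ` {l p..r p}"
    proof
      fix c assume c: "c \<in> D"
      then have "idx c \<in> num ` (lettered \<inter> {l p..r p})" using win by (auto simp: D_def)
      then obtain s where s: "s \<in> lettered" "s \<in> {l p..r p}" "idx c = idx (\<alpha> s)" by (auto simp: num_def)
      then have "c = \<alpha> s" using c inj_idx by (auto simp: D_def lettered_def inj_on_def)
      then show "c \<in> \<alpha> ` {l p..r p}" using s by blast
    qed
    show "idx ` D = {y..<y + t}"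
    proof
      show "{y..<y + t} \<subseteq> idx ` D"
      proof
        fix z assume z: "z \<in> {y..<y + t}"
        then obtain s where "s \<in> lettered" "z = idx (\<alpha> s)" using win by (auto simp: num_def)
        then show "z \<in> idx ` D" using z by (auto simp: D_def lettered_def)
      qed
    qed (auto simp: D_def)
  qed
  have "0 < card ?F" using \<open>t * M < t * card ?F\<close> by (cases "card ?F") simp_all
  then obtain p0 where p0: "p0 \<in> ?F" by (metis card_gt_0_iff ex_in_conv)
  have "card D = card (idx ` D)"
    using inj_idx by (intro card_image[symmetric]) (auto simp: D_def intro: inj_on_subset)
  then have "card D = t" using img[OF p0] by simp
  moreover have "crossed \<alpha> P D M"
    unfolding crossed_def
  proof (intro exI[of _ "(\<lambda>p. {l p..r p}) ` ?F"] conjI ballI)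
    let ?I = "(\<lambda>p. {l p..r p}) ` ?F"
    show "finite ?I" using finite_anchors by auto
    have "inj_on (\<lambda>p. {l p..r p}) ?F"
    proof (rule inj_onI)
      fix p q assume "p \<in> ?F" "q \<in> ?F" "{l p..r p} = {l q..r q}"
      then show "p = q" using same[of p q] ne[of q] by auto
    qed
    then show "M \<le> card ?I" using M by (simp add: card_image)
    show "disjoint ?I" unfolding disjoint_def using same by blast
    fix I assume "I \<in> ?I"
    then obtain p where p: "p \<in> ?F" "I = {l p..r p}" by blast
    show "I \<subseteq> P" using w[of p] p by auto
    show "D \<subseteq> \<alpha> ` I" using D[OF p(1)] p(2) by simp
    show "\<exists>l r. l \<le> r \<and> I = {l..r}" using ne[OF p(1)] p(2) by blast
  qed
  ultimately show False using not_crossed[of D] by (auto simp: D_def)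
qed

text \<open>The sweep over the letters: a window of \<open>t\<close> stars, so that short pieces can be hung on, and the anchors
  of two consecutive letters, so that the parts of long pieces between letters can be hung on.\<close>

definition bag :: "nat \<Rightarrow> ps_vertex set" where
  "bag x = Star_Vertex ` {c \<in> C. x \<le> idx c \<and> idx c < x + t} \<union>
     Path_Vertex ` (anchors x \<union> anchors (Suc x))"

lemma finite_bag: "finite (bag x)"
  using finite_C finite_anchors by (simp add: bag_def)

lemma card_bag: "card (bag x) \<le> t + 2 * (t * M)"
proof -
  let ?S = "{c \<in> C. x \<le> idx c \<and> idx c < x + t}"
  have "card (Star_Vertex ` ?S) \<le> card ?S" using finite_C by (intro card_image_le) simp
  also have "\<dots> = card (idx ` ?S)"
    using inj_idx by (intro card_image[symmetric]) (auto intro: inj_on_subset)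
  also have "\<dots> \<le> card {x..<x + t}" by (intro card_mono) auto
  finally have 1: "card (Star_Vertex ` ?S) \<le> t" by simp
  have "card (Path_Vertex ` (anchors x \<union> anchors (Suc x))) \<le> card (anchors x \<union> anchors (Suc x))"
    using finite_anchors by (intro card_image_le) simp
  also have "\<dots> \<le> card (anchors x) + card (anchors (Suc x))" by (rule card_Un_le)
  also have "\<dots> \<le> t * M + t * M" using card_anchors by (intro add_mono) auto
  finally have 2: "card (Path_Vertex ` (anchors x \<union> anchors (Suc x))) \<le> 2 * (t * M)" by simp
  have "card (bag x) \<le> card (Star_Vertex ` ?S) + card (Path_Vertex ` (anchors x \<union> anchors (Suc x)))"
    unfolding bag_def by (rule card_Un_le)
  then show ?thesis using 1 2 by linarith
qed

lemma Star_in_bag: "Star_Vertex c \<in> bag x \<longleftrightarrow> c \<in> C \<and> x \<le> idx c \<and> idx c < x + t"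
  by (auto simp: bag_def)

lemma Path_in_bag: "Path_Vertex p \<in> bag x \<longleftrightarrow> p \<in> anchors x \<or> p \<in> anchors (Suc x)"
  by (auto simp: bag_def)

lemma bag_running_intersection: "bag (Suc n) \<inter> (\<Union>x\<le>n. bag x) \<subseteq> bag n"
proof
  fix v assume v: "v \<in> bag (Suc n) \<inter> (\<Union>x\<le>n. bag x)"
  then obtain x where x: "x \<le> n" "v \<in> bag x" "v \<in> bag (Suc n)" by auto
  show "v \<in> bag n"
  proof (cases v)
    case (Path_Vertex p)
    then show ?thesis using x by (auto simp: Path_in_bag anchors_def)
  next
    case (Star_Vertex c)
    then show ?thesis using x by (auto simp: Star_in_bag)
  qed
qed

lemma tree_bags_bag: "tree_bags (t + 2 * (t * M) + 2) (bag ` {..n})"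
proof (induction n)
  case 0
  have "tree_bags (t + 2 * (t * M) + 2) {bag 0}"
    using card_bag[of 0] finite_bag by (intro tree_bags.single) auto
  then show ?case by simp
next
  case (Suc n)
  have "tree_bags (t + 2 * (t * M) + 2) (insert (bag (Suc n)) (bag ` {..n}))"
  proof (rule tree_bags.attach[OF Suc])
    show "bag n \<in> bag ` {..n}" by simp
    show "finite (bag (Suc n))" by (rule finite_bag)
    show "card (bag (Suc n)) \<le> t + 2 * (t * M) + 2" using card_bag[of "Suc n"] by simp
    show "bag (Suc n) \<inter> \<Union>(bag ` {..n}) \<subseteq> bag n" by (rule bag_running_intersection)
  qed
  then show ?case by (simp add: atMost_Suc)
qed

definition loose :: "nat set" where
  "loose = {p \<in> P. \<not> (p \<in> lettered \<and> long p)}"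

lemma not_loose: "p \<in> P \<Longrightarrow> p \<notin> loose \<Longrightarrow> p \<in> lettered \<and> long p"
  by (simp add: loose_def)

lemma anchorsI: "p \<in> P \<Longrightarrow> p \<notin> loose \<Longrightarrow> p \<in> anchors (num p)"
  by (simp add: loose_def anchors_def)

text \<open>All neighbours outside a maximal stretch of loose vertices lie in one bag. If the stretch belongs to
  a long piece, it has no letters, and it sits between (at most) two anchors with consecutive numbers.
  If it belongs to a short piece, it is that whole piece, and fewer than \<open>t\<close> consecutive letters
  are attached to it.\<close>

lemma loose_piece_has_bag:
  assumes bound: "\<And>c. c \<in> C \<Longrightarrow> idx c \<le> n" and l: "l \<in> loose"
    and left: "\<And>r. Suc r = l \<Longrightarrow> r \<notin> loose"
  shows "\<exists>x \<le> n. \<forall>q. l \<le> q \<longrightarrow> {l..q} \<subseteq> loose \<longrightarrow>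
    (Suc q \<in> P - loose \<longrightarrow> Path_Vertex (Suc q) \<in> bag x) \<and>
    (\<forall>r. Suc r = q \<longrightarrow> r \<in> P - loose \<longrightarrow> Path_Vertex r \<in> bag x) \<and>
    (\<alpha> q \<in> C \<longrightarrow> Star_Vertex (\<alpha> q) \<in> bag x)"
proof -
  have num_le: "num p \<le> n" if "p \<in> lettered" for p
    using that bound by (auto simp: num_def lettered_def)
  have LP: "loose \<subseteq> P" by (auto simp: loose_def)
  have jn: "joined l q" if "l \<le> q" "{l..q} \<subseteq> loose" for q
    using that LP joined_le by blast
  have pred: "q = l" if "l \<le> q" "{l..q} \<subseteq> loose" "Suc r = q" "r \<in> P - loose" for q r
  proof (rule ccontr)
    assume "q \<noteq> l"
    then have "r \<in> {l..q}" using that by auto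
    then show False using that by blast
  qed
  show ?thesis
  proof (cases "long l")
    case True
    have nolet: "q \<notin> lettered" if "l \<le> q" "{l..q} \<subseteq> loose" for q
    proof -
      have "long q" using long_joined[OF jn[OF that] True] .
      moreover have "q \<in> loose" using that by auto
      ultimately show ?thesis by (simp add: loose_def)
    qed
    have noC: "\<alpha> q \<notin> C" if "l \<le> q" "{l..q} \<subseteq> loose" for q
    proof -
      have "q \<in> loose" using that by auto
      then show ?thesis using nolet[OF that] LP by (auto simp: lettered_def)
    qed
    show ?thesis
    proof (cases "\<exists>r. Suc r = l \<and> r \<in> P - loose")
      case True
      then obtain r where r: "Suc r = l" "r \<in> P - loose" by blast
      have ra: "r \<in> anchors (num r)" "r \<in> lettered" using r anchorsI not_loose by auto
      have "Path_Vertex (Suc q) \<in> bag (num r)"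
        if q: "l \<le> q" "{l..q} \<subseteq> loose" "Suc q \<in> P - loose" for q
      proof -
        have qa: "Suc q \<in> anchors (num (Suc q))" "Suc q \<in> lettered" using q anchorsI not_loose by auto
        have "{r..Suc q} = insert r (insert (Suc q) {l..q})" using r(1) q(1) by auto
        then have sub: "{r..Suc q} \<subseteq> P" using q r LP by auto
        have "num (Suc q) = Suc (num r)"
          unfolding num_def
        proof (rule successor[OF _ sub])
          fix s assume s: "r < s" "s < Suc q"
          then have "l \<le> s" "{l..s} \<subseteq> {l..q}" using r(1) by auto
          then show "\<alpha> s \<notin> C" using noC q(2) by blast
        qed (use ra qa r q in \<open>auto simp: lettered_def\<close>)
        then show ?thesis using qa by (simp add: Path_in_bag)
      qed
      moreover have "Path_Vertex r' \<in> bag (num r)"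
        if "l \<le> q" "{l..q} \<subseteq> loose" "Suc r' = q" "r' \<in> P - loose" for q r'
      proof -
        have "r' = r" using pred[OF that] that(3) r(1) by simp
        then show ?thesis using ra by (simp add: Path_in_bag)
      qed
      ultimately show ?thesis using noC num_le[OF ra(2)] by (intro exI[of _ "num r"]) blast
    next
      case no_left: False
      show ?thesis
      proof (cases "\<exists>q. l \<le> q \<and> {l..q} \<subseteq> loose \<and> Suc q \<in> P - loose")
        case True
        then obtain q0 where q0: "l \<le> q0" "{l..q0} \<subseteq> loose" "Suc q0 \<in> P - loose" by blast
        have qa: "Suc q0 \<in> anchors (num (Suc q0))" "Suc q0 \<in> lettered" using q0 anchorsI not_loose by auto
        have uniq: "q = q0" if q: "l \<le> q" "{l..q} \<subseteq> loose" "Suc q \<in> P - loose" for q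
        proof (cases q q0 rule: linorder_cases)
          case less
          then have "Suc q \<in> {l..q0}" using q by auto
          then show ?thesis using q0 q by blast
        next
          case greater
          then have "Suc q0 \<in> {l..q}" using q0 by auto
          then show ?thesis using q0 q by blast
        qed
        have "Path_Vertex (Suc q) \<in> bag (num (Suc q0))"
          if "l \<le> q" "{l..q} \<subseteq> loose" "Suc q \<in> P - loose" for q
          using uniq[OF that] qa by (simp add: Path_in_bag)
        moreover have False if "l \<le> q" "{l..q} \<subseteq> loose" "Suc r' = q" "r' \<in> P - loose" for q r'
          using pred[OF that] no_left that by blast
        ultimately show ?thesis using noC num_le[OF qa(2)] by (intro exI[of _ "num (Suc q0)"]) blast
      next
        case False
        have "False" if "l \<le> q" "{l..q} \<subseteq> loose" "Suc r' = q" "r' \<in> P - loose" for q r'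
          using pred[OF that] no_left that by blast
        then show ?thesis using False noC by (intro exI[of _ 0]) blast
      qed
    qed
  next
    case short: False
    have noR: "Suc q \<notin> P - loose" if q: "l \<le> q" "{l..q} \<subseteq> loose" for q
    proof
      assume S: "Suc q \<in> P - loose"
      have "{l..Suc q} = insert (Suc q) {l..q}" using q(1) by auto
      then have "{l..Suc q} \<subseteq> P" using q LP S by auto
      then have "joined (Suc q) l" using joined_le[of l "Suc q"] q joined_sym by auto
      then show False using long_joined short not_loose S by blast
    qed
    have noL: "r \<notin> P - loose" if q: "l \<le> q" "{l..q} \<subseteq> loose" "Suc r = q" for q r
    proof
      assume S: "r \<in> P - loose"
      then have rl: "Suc r = l" using pred[OF q] q(3) by simp
      then have "{r..l} \<subseteq> P" using S l LP by (auto simp: le_Suc_eq atLeastAtMost_iff)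
      then have "joined r l" using joined_le[of r l] rl by auto
      then show False using long_joined short not_loose S by blast
    qed
    show ?thesis
    proof (cases "\<exists>q. l \<le> q \<and> {l..q} \<subseteq> loose \<and> \<alpha> q \<in> C")
      case False
      then show ?thesis using noR noL by (intro exI[of _ 0]) blast
    next
      case True
      define q0 where "q0 = (LEAST q. l \<le> q \<and> {l..q} \<subseteq> loose \<and> \<alpha> q \<in> C)"
      have q0: "l \<le> q0" "{l..q0} \<subseteq> loose" "\<alpha> q0 \<in> C"
        using LeastI_ex[OF True] unfolding q0_def by auto
      have in_lettered: "q \<in> lettered" if "l \<le> q" "{l..q} \<subseteq> loose" "\<alpha> q \<in> C" for q
      proof -
        have "q \<in> loose" using that by auto
        then show ?thesis using LP that by (auto simp: lettered_def)
      qed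
      have "Star_Vertex (\<alpha> q) \<in> bag (num q0)" if q: "l \<le> q" "{l..q} \<subseteq> loose" "\<alpha> q \<in> C" for q
      proof -
        have le: "q0 \<le> q" unfolding q0_def using q by (intro Least_le) blast
        have "joined l q" "joined q0 l" using jn[OF q(1,2)] jn[OF q0(1,2)] joined_sym by blast+
        then have j: "joined q0 q" using joined_trans by blast
        have "num q0 \<le> num q" using num_stretch_le(1)[OF le j] in_lettered q q0 by blast
        moreover have "\<not> num q0 + t \<le> Suc (num q)"
          using short le j \<open>joined q0 l\<close> in_lettered q q0 unfolding long_def by blast
        ultimately show ?thesis using q(3) by (simp add: Star_in_bag num_def)
      qed
      moreover have "num q0 \<le> n" using num_le in_lettered q0 by blast
      ultimately show ?thesis using noR noL by (intro exI[of _ "num q0"]) blast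
    qed
  qed
qed

text \<open>Every loose vertex is hung on the bag assigned to the stretch of loose vertices that contains it; the
  stretch is identified by its left end.\<close>

lemma decomposes_path_star: "decomposes (t + 2 * (t * M) + 2) (path_star_subgraph \<alpha> P C)"
proof -
  let ?k = "t + 2 * (t * M) + 2" and ?G = "path_star_subgraph \<alpha> P C"
  obtain n where n: "\<And>c. c \<in> C \<Longrightarrow> idx c \<le> n"
    using finite_C by (meson Max_ge finite_imageI imageI)
  have LP: "loose \<subseteq> P" by (auto simp: loose_def)
  \<comment> \<open>the bag of number \<open>x\<close> contains all outside neighbours of the stretch that starts at \<open>l\<close>\<close>
  define good where "good l x \<longleftrightarrow> x \<le> n \<and> (\<forall>q. l \<le> q \<longrightarrow> {l..q} \<subseteq> loose \<longrightarrow>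
    (Suc q \<in> P - loose \<longrightarrow> Path_Vertex (Suc q) \<in> bag x) \<and>
    (\<forall>r. Suc r = q \<longrightarrow> r \<in> P - loose \<longrightarrow> Path_Vertex r \<in> bag x) \<and>
    (\<alpha> q \<in> C \<longrightarrow> Star_Vertex (\<alpha> q) \<in> bag x))" for l x
  define start where "start p = (LEAST l. {l..p} \<subseteq> loose)" for p
  define Y where "Y p = bag (SOME x. good (start p) x)" for p
  have start: "start p \<le> p" "{start p..p} \<subseteq> loose" "start p \<in> loose" "\<And>r. Suc r = start p \<Longrightarrow> r \<notin> loose"
    if p: "p \<in> loose" for p
  proof -
    show le: "start p \<le> p" unfolding start_def using p by (intro Least_le) simp
    have "{p..p} \<subseteq> loose" using p by simp
    then show sub: "{start p..p} \<subseteq> loose" unfolding start_def by (rule LeastI)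
    then show "start p \<in> loose" using le by auto
    show "r \<notin> loose" if r: "Suc r = start p" for r
    proof
      assume "r \<in> loose"
      have "{r..p} = insert r {start p..p}" using r le by auto
      then have "{r..p} \<subseteq> loose" using sub \<open>r \<in> loose\<close> by simp
      then have "start p \<le> r" unfolding start_def by (rule Least_le)
      then show False using r by simp
    qed
  qed
  have start_Suc: "start (Suc p) = start p" if p: "p \<in> loose" "Suc p \<in> loose" for p
  proof (rule antisym)
    have "{start p..Suc p} = insert (Suc p) {start p..p}" using start(1)[OF p(1)] by auto
    then have "{start p..Suc p} \<subseteq> loose" using start(2)[OF p(1)] p(2) by simp
    then show "start (Suc p) \<le> start p" unfolding start_def[of "Suc p"] by (rule Least_le)
    have "{start (Suc p)..p} \<subseteq> {start (Suc p)..Suc p}" by auto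
    then have "{start (Suc p)..p} \<subseteq> loose" using start(2)[OF p(2)] by blast
    then show "start p \<le> start (Suc p)" unfolding start_def[of p] by (rule Least_le)
  qed
  have Y: "\<exists>x \<le> n. Y p = bag x \<and> good (start p) x" if p: "p \<in> loose" for p
  proof -
    have "\<exists>x. good (start p) x"
      using loose_piece_has_bag[OF n start(3,4)[OF p]] unfolding good_def by blast
    then have "good (start p) (SOME x. good (start p) x)" by (rule someI_ex)
    then show ?thesis unfolding Y_def good_def by blast
  qed
  have Ygood: "(Suc p \<in> P - loose \<longrightarrow> Path_Vertex (Suc p) \<in> Y p) \<and>
    (\<forall>r. Suc r = p \<longrightarrow> r \<in> P - loose \<longrightarrow> Path_Vertex r \<in> Y p) \<and>
    (\<alpha> p \<in> C \<longrightarrow> Star_Vertex (\<alpha> p) \<in> Y p)" if p: "p \<in> loose" for p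
    using Y[OF p] start(1,2)[OF p] unfolding good_def by auto
  define hang where "hang p = Y p \<union> Path_Vertex ` ({p - 1, p} \<inter> loose)" for p
  define Bs where "Bs = bag ` {..n} \<union> hang ` loose"
  have tb: "tree_bags ?k Bs"
    unfolding Bs_def hang_def
  proof (rule tree_bags_attach_paths[OF tree_bags_bag])
    show "finite loose" using LP finite_P finite_subset by blast
    fix p assume p: "p \<in> loose"
    obtain x where x: "x \<le> n" "Y p = bag x" using Y[OF p] by blast
    show "Y p \<in> bag ` {..n}" using x by simp
    show "card (Y p) + 2 \<le> ?k" using x(2) card_bag[of x] by simp
    show "Path_Vertex p \<notin> \<Union>(bag ` {..n})" using p by (auto simp: Path_in_bag anchors_def loose_def)
    show "Y (Suc p) = Y p" if "Suc p \<in> loose" using start_Suc[OF p that] by (simp add: Y_def)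
  qed
  have hangB: "hang p \<in> Bs" if "p \<in> loose" for p using that by (simp add: Bs_def)
  have bagB: "bag x \<in> Bs" if "x \<le> n" for x using that by (simp add: Bs_def)
  have num_le: "num p \<le> n" if "p \<in> lettered" for p using that n by (auto simp: num_def lettered_def)
  have anchored: "p \<in> anchors (num p) \<and> num p \<le> n \<and> p \<in> lettered" if "p \<in> P - loose" for p
    using that anchorsI not_loose num_le by blast
  have "\<Union>Bs = verts ?G"
    unfolding verts_path_star_subgraph
  proof
    have bagV: "bag x \<subseteq> Path_Vertex ` P \<union> Star_Vertex ` C" for x
      by (auto simp: bag_def anchors_def lettered_def)
    have "hang p \<subseteq> Path_Vertex ` P \<union> Star_Vertex ` C" if "p \<in> loose" for p
      using Y[OF that] bagV LP unfolding hang_def by blast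
    then show "\<Union>Bs \<subseteq> Path_Vertex ` P \<union> Star_Vertex ` C" using bagV unfolding Bs_def by blast
    show "Path_Vertex ` P \<union> Star_Vertex ` C \<subseteq> \<Union>Bs"
    proof
      fix v assume "v \<in> Path_Vertex ` P \<union> Star_Vertex ` C"
      then consider p where "v = Path_Vertex p" "p \<in> loose" | p where "v = Path_Vertex p" "p \<in> P - loose"
        | c where "v = Star_Vertex c" "c \<in> C" by blast
      then show "v \<in> \<Union>Bs"
      proof cases
        case 1
        then have "v \<in> hang p" by (simp add: hang_def)
        then show ?thesis using hangB 1 by blast
      next
        case 2
        then have "v \<in> bag (num p)" using anchored by (simp add: Path_in_bag)
        then show ?thesis using bagB anchored 2 by blast
      next
        case 3
        then have "v \<in> bag (idx c)" using t_pos by (simp add: Star_in_bag)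
        then show ?thesis using bagB n 3 by blast
      qed
    qed
  qed
  moreover have "\<exists>X \<in> Bs. e \<subseteq> X" if "e \<in> edges ?G" for e
  proof -
    consider p where "e = {Path_Vertex p, Path_Vertex (Suc p)}" "p \<in> P" "Suc p \<in> P"
      | p where "e = {Path_Vertex p, Star_Vertex (\<alpha> p)}" "p \<in> P" "\<alpha> p \<in> C"
      using \<open>e \<in> edges ?G\<close> unfolding edges_path_star_subgraph by blast
    then show ?thesis
    proof cases
      case 1
      consider "Suc p \<in> loose" | "Suc p \<notin> loose" "p \<in> loose" | "Suc p \<notin> loose" "p \<notin> loose" by blast
      then show ?thesis
      proof cases
        case a: 1
        then have "e \<subseteq> hang (Suc p)"
          using 1 Ygood[of "Suc p"] by (cases "p \<in> loose") (auto simp: hang_def)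
        then show ?thesis using hangB[OF a] by blast
      next
        case a: 2
        then have "e \<subseteq> hang p" using 1 Ygood[of p] by (auto simp: hang_def)
        then show ?thesis using hangB[OF a(2)] by blast
      next
        case a: 3
        then have an: "p \<in> anchors (num p)" "Suc p \<in> anchors (num (Suc p))" "num p \<le> n"
          "p \<in> lettered" "Suc p \<in> lettered"
          using 1 anchored by auto
        have "num (Suc p) = Suc (num p)"
          unfolding num_def by (rule successor) (use 1 an in \<open>auto simp: lettered_def le_Suc_eq\<close>)
        then have "e \<subseteq> bag (num p)" using 1 an by (auto simp: Path_in_bag)
        then show ?thesis using bagB an by blast
      qed
    next
      case 2
      show ?thesis
      proof (cases "p \<in> loose")
        case True
        then have "e \<subseteq> hang p" using 2 Ygood[of p] by (auto simp: hang_def)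
        then show ?thesis using hangB True by blast
      next
        case False
        then have "p \<in> anchors (num p)" "num p \<le> n" using 2 anchored by auto
        moreover from this have "e \<subseteq> bag (num p)"
          using 2 t_pos by (auto simp: Path_in_bag Star_in_bag num_def)
        ultimately show ?thesis using bagB by blast
      qed
    qed
  qed
  ultimately show ?thesis using tb unfolding decomposes_def by blast
qed

end

section \<open>Large tree-width at large girth\<close>

context nested_word
begin

text \<open>If the occurrences of the letters of \<open>C\<close> are further apart than the number of path vertices, then
  no piece of the path meets two letters, so windows of two letters are not crossed at all. The bound
  is \<open>t + 2 * (t * M) + 2\<close> for \<open>t = 2\<close> and \<open>M = 1\<close>.\<close>

lemma spread_imp_small_subgraphs_narrow:
  assumes "spread g C" "finite P" "finite C" "card P \<le> g"
  shows "treewidth (path_star_subgraph \<alpha> P C) \<le> 8"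
proof -
  have far: False if "p < q" "{p..q} \<subseteq> P" "\<alpha> p \<in> C" "\<alpha> q \<in> C" for p q
  proof -
    have "p + g < q" using assms(1) that by (auto simp: spread_def)
    then have "g < card {p..q}" by simp
    also have "\<dots> \<le> card P" using that assms(2) by (intro card_mono) auto
    finally show False using assms(4) by simp
  qed
  interpret consecutive_path_star \<alpha> P C id 2 1
  proof
    show "\<not> crossed \<alpha> P D 1" if D: "D \<subseteq> C" "card D = 2" for D
    proof
      assume "crossed \<alpha> P D 1"
      then obtain \<I> where I: "finite \<I>" "1 \<le> card \<I>"
        "\<forall>I \<in> \<I>. I \<subseteq> P \<and> D \<subseteq> \<alpha> ` I \<and> (\<exists>l r. l \<le> r \<and> I = {l..r})" by (auto simp: crossed_def)
      then obtain I where "I \<in> \<I>" by (metis card.empty ex_in_conv not_one_le_zero)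
      with I(3) have "I \<subseteq> P \<and> D \<subseteq> \<alpha> ` I \<and> (\<exists>l r. l \<le> r \<and> I = {l..r})" by (rule bspec)
      then obtain l r where lr: "{l..r} \<subseteq> P" "D \<subseteq> \<alpha> ` {l..r}" by metis
      obtain c d where cd: "D = {c, d}" "c \<noteq> d" using D(2) by (auto simp: card_2_iff)
      then have "c \<in> \<alpha> ` {l..r}" "d \<in> \<alpha> ` {l..r}" using lr(2) by auto
      then obtain p q where pq: "p \<in> {l..r}" "q \<in> {l..r}" "\<alpha> p = c" "\<alpha> q = d" by (metis imageE)
      have "{p..q} \<subseteq> P" "{q..p} \<subseteq> P" using pq lr(1) by (auto simp: subset_iff)
      then show False using far[of p q] far[of q p] pq cd D(1) by (cases p q rule: linorder_cases) auto
    qed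
  qed (use assms far in auto)
  show ?thesis using treewidth_le_if_decomposes[OF decomposes_path_star] by simp
qed

definition branch_of :: "nat \<Rightarrow> nat" where
  "branch_of x = (THE i. x \<in> H i)"

lemma branch_of_eq: "x \<in> H i \<Longrightarrow> branch_of x = i"
  unfolding branch_of_def using branch_unique by (intro the_equality) auto

text \<open>The letters are listed branch by branch, each branch in increasing order; \<open>card (below C x)\<close> is the
  position of \<open>x\<close> in this list. Letters that are neighbours in a branch get consecutive positions.\<close>

definition below :: "nat set \<Rightarrow> nat \<Rightarrow> nat set" where
  "below C x = {y \<in> C. branch_of y < branch_of x \<or> branch_of y = branch_of x \<and> y < x}"

lemma inj_on_card_below:
  assumes "finite C" shows "inj_on (\<lambda>x. card (below C x)) C"
proof (rule inj_onI)
  fix x y assume xy: "x \<in> C" "y \<in> C" "card (below C x) = card (below C y)"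
  have mono: "card (below C u) < card (below C v)" if "u \<in> C" "u \<in> below C v" for u v
  proof (rule psubset_card_mono)
    show "finite (below C v)" using assms by (simp add: below_def)
    show "below C u \<subset> below C v" using that by (auto simp: below_def)
  qed
  show "x = y"
  proof (rule ccontr)
    assume "x \<noteq> y"
    then have "x \<in> below C y \<or> y \<in> below C x" using xy by (auto simp: below_def)
    then show False using mono xy by fastforce
  qed
qed

lemma card_below_successor:
  assumes "finite C" "C \<subseteq> \<Union>(range H)" "x \<in> C" "x \<in> H i" "y \<in> H i" "x < y"
    and none: "\<And>z. z \<in> C \<inter> H i \<Longrightarrow> \<not> (x < z \<and> z < y)"
  shows "card (below C y) = Suc (card (below C x))"
proof -
  have b: "branch_of x = i" "branch_of y = i" using assms branch_of_eq by auto
  have in_i: "z \<in> H i" if "z \<in> C" "branch_of z = i" for z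
    using that assms(2) branch_of_eq by blast
  have "below C y = insert x (below C x)"
  proof
    show "below C y \<subseteq> insert x (below C x)"
    proof
      fix z assume z: "z \<in> below C y"
      show "z \<in> insert x (below C x)"
      proof (cases "branch_of z = i")
        case True
        then have "z \<in> C \<inter> H i" "z < y" using z in_i b by (auto simp: below_def)
        then have "z \<le> x" using none[of z] by auto
        then show ?thesis using True z b by (auto simp: below_def)
      next
        case False
        then show ?thesis using z b by (auto simp: below_def)
      qed
    qed
    show "insert x (below C x) \<subseteq> below C y" using assms b by (auto simp: below_def)
  qed
  moreover have "x \<notin> below C x" "finite (below C x)" using assms(1) by (auto simp: below_def)
  ultimately show ?thesis by simp
qed

text \<open>Thinning out a crossed set of letters loses a factor \<open>g + 1\<close> of its size, but the intervals still
  cross what is left.\<close>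

lemma crossed_imp_spread_wide:
  assumes C: "C \<subseteq> level S g" "finite C" "Suc g * k \<le> card C" and "crossed \<alpha> P C k" "finite P"
  shows "\<exists>C' \<subseteq> C. spread g C' \<and> k \<le> Suc (treewidth (path_star_subgraph \<alpha> P C'))"
proof -
  obtain C' where C': "C' \<subseteq> C" "card C \<le> card C' * Suc g"
    and thin: "\<forall>i. \<forall>x \<in> C' \<inter> H i. \<forall>y \<in> C' \<inter> H i. x < y \<longrightarrow> g \<le> card {z \<in> C \<inter> H i. x < z \<and> z < y}"
    using thin_branches[OF C(2), of g] by blast
  have "Suc g * k \<le> Suc g * card C'" using C(3) C'(2) by (simp only: mult.commute[of "card C'"])
  then have k: "k \<le> card C'" by (simp only: Suc_mult_le_cancel1)
  have "spread g C'"
    using thin by (intro spread_if_thin[OF C(1) C'(1) C(2)]) blast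
  moreover have "k \<le> Suc (treewidth (path_star_subgraph \<alpha> P C'))"
  proof (rule treewidth_ge_if_crossed)
    show "crossed \<alpha> P C' k" using assms(4) C'(1) by (rule crossed_mono[OF _ order_refl])
    show "finite C'" using C'(1) C(2) finite_subset by blast
  qed fact+
  ultimately show ?thesis using C'(1) by blast
qed

text \<open>Every rich interval contains one letter of each of the first \<open>t\<close> layers. There are at most
  \<open>b ^ t\<close> ways to choose one letter from each layer, so \<open>k\<close> of the intervals share the same
  choice. The letters chosen from the layers \<open>g\<close> and above lie in the level \<open>g\<close>.\<close>

lemma many_rich_intervals_imp_crossed:
  assumes fin: "finite \<I>" and card: "k * b ^ t \<le> card \<I>" and "0 < k" and "disjoint \<I>"
    and I: "\<And>I. I \<in> \<I> \<Longrightarrow> I \<subseteq> P \<and> (\<exists>l r. l \<le> r \<and> I = {l..r})"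
    and rich: "\<And>I j. I \<in> \<I> \<Longrightarrow> j < t \<Longrightarrow> layer S j \<inter> \<alpha> ` I \<noteq> {}"
  shows "\<exists>C \<subseteq> level S g. finite C \<and> card C = t - g \<and> crossed \<alpha> P C k"
proof -
  define \<phi> where "\<phi> I = (\<lambda>j \<in> {..<t}. SOME c. c \<in> layer S j \<inter> \<alpha> ` I)" for I
  have \<phi>: "\<phi> I j \<in> layer S j \<inter> \<alpha> ` I" if Ij: "I \<in> \<I>" "j < t" for I j
  proof -
    have "\<exists>c. c \<in> layer S j \<inter> \<alpha> ` I" using rich[OF Ij] by blast
    then have "(SOME c. c \<in> layer S j \<inter> \<alpha> ` I) \<in> layer S j \<inter> \<alpha> ` I" by (rule someI_ex)
    then show ?thesis using Ij by (simp add: \<phi>_def)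
  qed
  let ?\<Phi> = "PiE {..<t} (layer S)"
  have into: "\<phi> \<in> \<I> \<rightarrow> ?\<Phi>"
  proof (intro Pi_I PiE_I)
    show "\<phi> I j \<in> layer S j" if "I \<in> \<I>" "j \<in> {..<t}" for I j using \<phi>[of I j] that by simp
  qed (simp add: \<phi>_def)
  have fin\<Phi>: "finite ?\<Phi>" using finite_layer by (intro finite_PiE) auto
  have "card ?\<Phi> = (\<Prod>j<t. card (layer S j))" by (simp add: card_PiE)
  also have "\<dots> \<le> (\<Prod>j<t. b)" by (intro prod_mono) (simp add: card_layer)
  finally have card\<Phi>: "card ?\<Phi> \<le> b ^ t" by simp
  have bt: "0 < b ^ t" using b_pos by simp
  have "0 < card \<I>" using card bt \<open>0 < k\<close> by (metis mult_pos_pos order_less_le_trans)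
  then obtain I0 where "I0 \<in> \<I>" by (metis card_gt_0_iff ex_in_conv)
  then have "?\<Phi> \<noteq> {}" using into by blast
  then have "\<exists>y \<in> ?\<Phi>. card \<I> \<le> card (\<phi> -` {y} \<inter> \<I>) * card ?\<Phi>"
    by (intro pigeonhole_card into fin fin\<Phi>)
  then obtain \<psi> where "card \<I> \<le> card (\<phi> -` {\<psi>} \<inter> \<I>) * card ?\<Phi>" by blast
  also have "\<dots> \<le> card (\<phi> -` {\<psi>} \<inter> \<I>) * b ^ t" using card\<Phi> by simp
  finally have "card \<I> \<le> card (\<phi> -` {\<psi>} \<inter> \<I>) * b ^ t" .
  with card have "k * b ^ t \<le> card (\<phi> -` {\<psi>} \<inter> \<I>) * b ^ t" by (rule order_trans)
  then have kF: "k \<le> card (\<phi> -` {\<psi>} \<inter> \<I>)" using bt by (simp only: mult_le_cancel2)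
  let ?F = "\<phi> -` {\<psi>} \<inter> \<I>"
  have \<psi>: "\<psi> j \<in> layer S j \<inter> \<alpha> ` I" if "I \<in> ?F" "j < t" for I j using \<phi>[of I j] that by auto
  have "0 < card ?F" using kF \<open>0 < k\<close> by simp
  then obtain I1 where I1: "I1 \<in> ?F" by (metis card_gt_0_iff ex_in_conv)
  let ?C = "\<psi> ` {g..<t}"
  have "inj_on \<psi> {g..<t}"
  proof (rule inj_onI)
    fix i j assume "i \<in> {g..<t}" "j \<in> {g..<t}" "\<psi> i = \<psi> j"
    then show "i = j" using \<psi>[OF I1, of i] \<psi>[OF I1, of j] layers_disjoint by auto
  qed
  then have "card ?C = t - g" by (simp add: card_image)
  moreover have "?C \<subseteq> level S g"
  proof
    fix c assume "c \<in> ?C"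
    then obtain j where j: "g \<le> j" "j < t" "c = \<psi> j" by auto
    then show "c \<in> level S g"
      using \<psi>[OF I1 j(2)] layer_subset_level[of S j] level_antimono[OF j(1), of S] by blast
  qed
  moreover have "crossed \<alpha> P ?C k"
    unfolding crossed_def
  proof (intro exI[of _ ?F] conjI ballI)
    show "finite ?F" using fin by simp
    show "disjoint ?F" using \<open>disjoint \<I>\<close> unfolding disjoint_def by blast
    fix I assume F: "I \<in> ?F"
    then have "I \<in> \<I>" by blast
    from I[OF this] show "I \<subseteq> P" "\<exists>l r. l \<le> r \<and> I = {l..r}" by blast+
    show "?C \<subseteq> \<alpha> ` I" using \<psi>[OF F] by auto
  qed (rule kF)
  ultimately show ?thesis by (intro exI[of _ ?C]) simp
qed

text \<open>Call an interval of the path rich if it meets each of the first \<open>t\<close> layers. With many disjoint rich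
  intervals, the preceding lemma provides letters crossed by \<open>k\<close> intervals. Otherwise few path
  vertices hit all rich intervals; removing them together with the letters of the first \<open>t\<close> layers
  leaves a graph in which every piece of the path misses some layer, so that it spells consecutive
  letters of one branch of the level \<open>t\<close>. Then either \<open>k\<close> of the pieces cross a common window,
  or the tree-width is bounded.\<close>

lemma wide_contains_spread_wide:
  assumes "0 < k"
  shows "\<exists>K. \<forall>P S. finite P \<longrightarrow> finite S \<longrightarrow> K < treewidth (path_star_subgraph \<alpha> P S) \<longrightarrow>
    (\<exists>C \<subseteq> S. spread g C \<and> k \<le> Suc (treewidth (path_star_subgraph \<alpha> P C)))"
proof -
  \<comment> \<open>\<open>w\<close> letters leave \<open>k\<close> after thinning, and the layers \<open>g\<close> to \<open>t - 1\<close> provide \<open>w\<close> letters\<close>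
  define w where "w = Suc g * k"
  define t where "t = g + w"
  define N where "N = k * b ^ t"
  define K where "K = w + 2 * (w * k) + 2 + (N + t * b)"
  have w: "0 < w" using assms by (simp add: w_def)
  have tpos: "0 < t" using w by (simp add: t_def)
  have "\<exists>C \<subseteq> S. spread g C \<and> k \<le> Suc (treewidth (path_star_subgraph \<alpha> P C))"
    if P: "finite P" and S: "finite S" and wide: "K < treewidth (path_star_subgraph \<alpha> P S)" for P S
  proof -
    have finish: ?thesis
      if C: "C \<subseteq> level S g" "card C = w" and cr: "crossed \<alpha> P C k" for C
    proof -
      have CS: "C \<subseteq> S" using C(1) level_eq[of S g] by blast
      then have "finite C" using S finite_subset by blast
      then obtain C' where "C' \<subseteq> C" "spread g C'" "k \<le> Suc (treewidth (path_star_subgraph \<alpha> P C'))"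
        using crossed_imp_spread_wide[OF C(1) _ _ cr P] C(2) unfolding w_def by auto
      moreover from this have "C' \<subseteq> S" using CS by blast
      ultimately show ?thesis by blast
    qed
    consider \<I> where "finite \<I>" "card \<I> = N" "disjoint \<I>"
        "\<forall>I \<in> \<I>. I \<subseteq> P \<and> (\<forall>j<t. layer S j \<inter> \<alpha> ` I \<noteq> {}) \<and> (\<exists>l r. l \<le> r \<and> I = {l..r})"
      | Z where "Z \<subseteq> P" "card Z \<le> N"
        "\<forall>l r. l \<le> r \<longrightarrow> {l..r} \<subseteq> P - Z \<longrightarrow> \<not> (\<forall>j<t. layer S j \<inter> \<alpha> ` {l..r} \<noteq> {})"
      using disjoint_intervals_or_hitting_set[OF P, of N "\<lambda>I. \<forall>j<t. layer S j \<inter> \<alpha> ` I \<noteq> {}"] by blast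
    then show ?thesis
    proof cases
      case 1
      have "\<exists>C \<subseteq> level S g. finite C \<and> card C = t - g \<and> crossed \<alpha> P C k"
      proof (rule many_rich_intervals_imp_crossed[OF 1(1) _ assms 1(3)])
        show "k * b ^ t \<le> card \<I>" using 1(2) by (simp add: N_def)
        show "I \<subseteq> P \<and> (\<exists>l r. l \<le> r \<and> I = {l..r})" if "I \<in> \<I>" for I using 1(4) that by blast
        show "layer S j \<inter> \<alpha> ` I \<noteq> {}" if "I \<in> \<I>" "j < t" for I j using 1(4) that by blast
      qed
      then show ?thesis using finish by (auto simp: t_def)
    next
      case 2
      let ?C = "level S t" and ?P = "P - Z"
      show ?thesis
      proof (cases "\<exists>D \<subseteq> ?C. card D = w \<and> crossed \<alpha> ?P D k")
        case True
        then obtain D where D: "D \<subseteq> ?C" "card D = w" "crossed \<alpha> ?P D k" by blast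
        have "D \<subseteq> level S g" using D(1) level_antimono[of g t S] by (auto simp: t_def)
        moreover have "crossed \<alpha> P D k" using crossed_mono[OF D(3)] by blast
        ultimately show ?thesis using finish D(2) by blast
      next
        case False
        have finC: "finite ?C" using S level_eq[of S t] by simp
        have brC: "?C \<subseteq> \<Union>(range H)" by (rule level_in_branch[OF tpos])
        interpret consecutive_path_star \<alpha> ?P ?C "\<lambda>x. card (below ?C x)" w k
        proof
          show "inj_on (\<lambda>x. card (below ?C x)) ?C" by (rule inj_on_card_below[OF finC])
          show "\<not> crossed \<alpha> ?P D k" if "D \<subseteq> ?C" "card D = w" for D using False that by blast
          fix p q assume pq: "p < q" "{p..q} \<subseteq> ?P" "\<alpha> p \<in> ?C" "\<alpha> q \<in> ?C"
            and none: "\<And>r. p < r \<Longrightarrow> r < q \<Longrightarrow> \<alpha> r \<notin> ?C"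
          obtain j where j: "j < t" "layer S j \<inter> \<alpha> ` {p..q} = {}" using 2(3) pq by (meson less_imp_le)
          have Cj: "?C \<subseteq> level S (Suc j)" "?C \<subseteq> level S j"
            using level_antimono[of "Suc j" t S] level_antimono[of j t S] j(1) by auto
          have "\<exists>i. \<alpha> p \<in> H i \<and> \<alpha> q \<in> H i \<and> \<alpha> p < \<alpha> q \<and>
            (\<forall>y \<in> H i \<inter> (level S j - base (level S j)). \<alpha> p < y \<and> y < \<alpha> q \<longrightarrow> (\<exists>r. p < r \<and> r < q \<and> \<alpha> r = y))"
          proof (rule stretch_without_base[OF pq(1)])
            show "\<alpha> p \<in> level S j" "\<alpha> q \<in> level S j" using pq Cj by blast+
            show "\<alpha> r \<notin> base (level S j)" if "p \<le> r" "r \<le> q" for r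
              using j(2) that by (auto simp: layer_def)
          qed
          then obtain i where i: "\<alpha> p \<in> H i" "\<alpha> q \<in> H i" "\<alpha> p < \<alpha> q"
            and ex: "\<And>y. y \<in> H i \<inter> level S (Suc j) \<Longrightarrow> \<alpha> p < y \<Longrightarrow> y < \<alpha> q \<Longrightarrow> \<exists>r. p < r \<and> r < q \<and> \<alpha> r = y"
            by auto
          show "card (below ?C (\<alpha> q)) = Suc (card (below ?C (\<alpha> p)))"
          proof (rule card_below_successor[OF finC brC pq(3) i])
            fix z assume z: "z \<in> ?C \<inter> H i"
            show "\<not> (\<alpha> p < z \<and> z < \<alpha> q)"
            proof
              assume "\<alpha> p < z \<and> z < \<alpha> q"
              then obtain r where "p < r" "r < q" "\<alpha> r = z" using ex[of z] z Cj(1) by blast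
              then show False using none z by blast
            qed
          qed
        qed (use P finC w in auto)
        let ?L = "\<Union>j<t. layer S j"
        let ?X = "Path_Vertex ` Z \<union> Star_Vertex ` ?L"
        have finZ: "finite Z" using finite_subset[OF 2(1) P] .
        then have finX: "finite ?X" using finite_layer by simp
        have "card ?L \<le> (\<Sum>j<t. card (layer S j))" by (rule card_UN_le) simp
        also have "\<dots> \<le> (\<Sum>j<t. b)" by (intro sum_mono card_layer)
        finally have "card ?L \<le> t * b" by simp
        moreover have "card (Star_Vertex ` ?L) \<le> card ?L" using finite_layer by (intro card_image_le) auto
        moreover have "card (Path_Vertex ` Z) \<le> card Z" by (rule card_image_le[OF finZ])
        ultimately have "card ?X \<le> N + t * b"
          using card_Un_le[of "Path_Vertex ` Z" "Star_Vertex ` ?L"] 2(2) by linarith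
        have LS: "?L \<subseteq> S" using layer_subset_level level_eq by blast
        have "(Path_Vertex ` ?P \<union> Star_Vertex ` ?C) \<union> ?X = Path_Vertex ` P \<union> Star_Vertex ` S"
          using 2(1) LS unfolding level_eq[of S t] by auto
        then have "decomposes (w + 2 * (w * k) + 2 + card ?X) (path_star_subgraph \<alpha> P S)"
          using decomposes_add_vertices[OF decomposes_path_star[unfolded path_star_subgraph_def] finX simple_path_star_graph]
          unfolding path_star_subgraph_def by simp
        then have "treewidth (path_star_subgraph \<alpha> P S) \<le> w + 2 * (w * k) + 2 + card ?X"
          by (rule treewidth_le_if_decomposes)
        then show ?thesis using wide \<open>card ?X \<le> N + t * b\<close> by (simp add: K_def)
      qed
    qed
  qed
  then show ?thesis by blast
qed

end

section \<open>No minimal class\<close>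

lemma ps_vertex_set_split:
  obtains P S where "W = Path_Vertex ` P \<union> Star_Vertex ` S"
proof
  show "W = Path_Vertex ` (Path_Vertex -` W) \<union> Star_Vertex ` (Star_Vertex -` W)"
    by (auto simp: image_iff) (metis ps_vertex.exhaust)
qed

lemma path_star_class_imp:
  assumes "G \<in> path_star_class \<alpha>"
  obtains P S where "finite P" "finite S" "isomorphic G (path_star_subgraph \<alpha> P S)"
proof -
  obtain W where W: "finite W" "isomorphic G (induced_subgraph (path_star_graph \<alpha>) W)"
    using assms by (auto simp: path_star_class_def)
  obtain P S where PS: "W = Path_Vertex ` P \<union> Star_Vertex ` S" by (rule ps_vertex_set_split)
  have "inj_on Path_Vertex P" "inj_on Star_Vertex S" by (auto simp: inj_on_def)
  then have "finite P" "finite S" using W(1) finite_imageD unfolding PS by auto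
  then show thesis using that W(2) unfolding PS path_star_subgraph_def by blast
qed

lemma induced_path_star_subgraph:
  "P' \<subseteq> P \<Longrightarrow> S' \<subseteq> S \<Longrightarrow>
    induced_subgraph (path_star_subgraph \<alpha> P S) (Path_Vertex ` P' \<union> Star_Vertex ` S') = path_star_subgraph \<alpha> P' S'"
  unfolding path_star_subgraph_def by (intro induced_subgraph_twice Un_mono image_mono)

lemma hereditary_path_star_subgraph:
  assumes "hereditary D" "G \<in> D" "isomorphic G (path_star_subgraph \<alpha> P S)" "C \<subseteq> S"
  obtains G' where "G' \<in> D" "isomorphic G' (path_star_subgraph \<alpha> P C)"
proof -
  let ?U = "Path_Vertex ` P \<union> Star_Vertex ` C"
  have "?U \<subseteq> verts (path_star_subgraph \<alpha> P S)" using assms(4) by (auto simp: verts_path_star_subgraph)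
  then obtain U' where U': "U' \<subseteq> verts G"
    "isomorphic (induced_subgraph (path_star_subgraph \<alpha> P S) ?U) (induced_subgraph G U')"
    by (rule isomorphic_induced_subgraph[OF isomorphic_sym[OF assms(3)]])
  have "induced_subgraph G U' \<in> D" using assms(1,2) U'(1) by (auto simp: hereditary_def)
  moreover have "isomorphic (induced_subgraph G U') (path_star_subgraph \<alpha> P C)"
    using isomorphic_sym[OF U'(2)] induced_path_star_subgraph[OF order_refl assms(4)] by simp
  ultimately show thesis by (rule that)
qed

text \<open>This stands in for large girth: in a graph without short cycles, small vertex sets induce forests.
  Bounding the tree-width of small induced subgraphs by a constant instead makes it immediate that a
  graph of larger tree-width violates the property once \<open>g\<close> reaches its order.\<close>

definition small_parts_narrow :: "nat \<Rightarrow> nat \<Rightarrow> 'a graph \<Rightarrow> bool" where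
  "small_parts_narrow g k G \<longleftrightarrow> (\<forall>U \<subseteq> verts G. card U \<le> g \<longrightarrow> treewidth (induced_subgraph G U) \<le> k)"

lemma small_parts_narrow_isomorphic:
  assumes iso: "isomorphic G G'" and G: "simple_graph G" "finite (verts G)" and G': "simple_graph G'"
    and narrow: "small_parts_narrow g k G'"
  shows "small_parts_narrow g k G"
  unfolding small_parts_narrow_def
proof (intro allI impI)
  fix U assume U: "U \<subseteq> verts G" "card U \<le> g"
  obtain U' where U': "U' \<subseteq> verts G'" "card U' = card U"
    "isomorphic (induced_subgraph G U) (induced_subgraph G' U')"
    by (rule isomorphic_induced_subgraph[OF iso U(1)])
  have "treewidth (induced_subgraph G' U') = treewidth (induced_subgraph G U)"
  proof (rule isomorphic_treewidth_eq[OF U'(3)])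
    show "finite (verts (induced_subgraph G U))"
      using U(1) G(2) finite_subset by (auto simp: induced_subgraph_def)
  qed (use G G' in \<open>auto intro: simple_induced_subgraph\<close>)
  moreover have "treewidth (induced_subgraph G' U') \<le> k"
    using narrow U U' by (simp add: small_parts_narrow_def)
  ultimately show "treewidth (induced_subgraph G U) \<le> k" by simp
qed

lemma hereditary_small_parts_narrow:
  assumes D: "hereditary D"
  shows "hereditary {G \<in> D. small_parts_narrow g k G}"
  unfolding hereditary_def
proof (intro conjI ballI allI impI)
  fix G assume G: "G \<in> {G \<in> D. small_parts_narrow g k G}"
  show sG: "simple_graph G" "finite (verts G)" using D G by (auto simp: hereditary_def)
  fix W assume W: "W \<subseteq> verts G"
  have "small_parts_narrow g k (induced_subgraph G W)"
    unfolding small_parts_narrow_def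
  proof (intro allI impI)
    fix U assume "U \<subseteq> verts (induced_subgraph G W)" "card U \<le> g"
    then have U: "U \<subseteq> W" "card U \<le> g" by (auto simp: induced_subgraph_def)
    then have "U \<subseteq> verts G" using W by blast
    then show "treewidth (induced_subgraph (induced_subgraph G W) U) \<le> k"
      using G U unfolding small_parts_narrow_def induced_subgraph_twice[OF U(1)] by blast
  qed
  moreover have "induced_subgraph G W \<in> D" using D G W by (auto simp: hereditary_def)
  ultimately show "induced_subgraph G W \<in> {G \<in> D. small_parts_narrow g k G}" by blast
next
  fix G G' :: "nat graph" assume G: "G \<in> {G \<in> D. small_parts_narrow g k G}" and G': "simple_graph G' \<and> isomorphic G G'"
  have sG: "simple_graph G" "finite (verts G)" using D G by (auto simp: hereditary_def)
  have "G' \<in> D" using D G G' unfolding hereditary_def by blast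
  moreover from this have "finite (verts G')" using D by (auto simp: hereditary_def)
  moreover have "small_parts_narrow g k G'"
    using small_parts_narrow_isomorphic[OF isomorphic_sym] G G' sG(1) \<open>finite (verts G')\<close> by blast
  ultimately show "G' \<in> {G \<in> D. small_parts_narrow g k G}" by blast
qed

lemma (in nested_word) small_parts_narrow_if_spread:
  assumes "spread g C" "finite P" "finite C"
  shows "small_parts_narrow g 8 (path_star_subgraph \<alpha> P C)"
  unfolding small_parts_narrow_def
proof (intro allI impI)
  fix U assume U: "U \<subseteq> verts (path_star_subgraph \<alpha> P C)" "card U \<le> g"
  obtain P' C' where PC: "U = Path_Vertex ` P' \<union> Star_Vertex ` C'" by (rule ps_vertex_set_split)
  then have sub: "P' \<subseteq> P" "C' \<subseteq> C" using U(1) by (auto simp: verts_path_star_subgraph)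
  then have fin: "finite P'" "finite C'" using assms finite_subset by blast+
  have "inj_on Path_Vertex P'" by (auto simp: inj_on_def)
  then have "card P' = card (Path_Vertex ` P')" by (simp add: card_image)
  also have "\<dots> \<le> card U" using fin unfolding PC by (intro card_mono) auto
  finally have "card P' \<le> g" using U(2) by simp
  moreover have "spread g C'" using assms(1) sub(2) unfolding spread_def by blast
  ultimately show "treewidth (induced_subgraph (path_star_subgraph \<alpha> P C) U) \<le> 8"
    using spread_imp_small_subgraphs_narrow fin unfolding PC induced_path_star_subgraph[OF sub] by blast
qed

theorem theorem6p4:
  fixes \<alpha> :: "nat \<Rightarrow> nat"
  assumes "nested \<alpha>"
  shows "\<not> (\<exists>D. hereditary D \<and> D \<subseteq> path_star_class \<alpha> \<and> minimal_unbounded_treewidth D)"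
proof
  assume "\<exists>D. hereditary D \<and> D \<subseteq> path_star_class \<alpha> \<and> minimal_unbounded_treewidth D"
  then obtain D where D: "hereditary D" "D \<subseteq> path_star_class \<alpha>" "\<not> bounded_treewidth D"
    and minimal: "\<And>D'. hereditary D' \<Longrightarrow> D' \<subset> D \<Longrightarrow> bounded_treewidth D'"
    unfolding minimal_unbounded_treewidth_def by blast
  obtain H base b where "nested_word \<alpha> H base b" using nested_imp_nested_word[OF assms] by blast
  then interpret nested_word \<alpha> H base b .
  have wide: "\<exists>G \<in> D. k < treewidth G" for k
    using D(3) unfolding bounded_treewidth_def by (meson not_le)
  have simple: "simple_graph G" "finite (verts G)" if "G \<in> D" for G
    using D(1) that by (auto simp: hereditary_def)
  \<comment> \<open>the order of any member of tree-width above \<open>8\<close> tells how far the stars must be spread\<close>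
  obtain F where F: "F \<in> D" "8 < treewidth F" using wide by blast
  define g where "g = card (verts F)"
  define D' where "D' = {G \<in> D. small_parts_narrow g 8 G}"
  have "\<not> small_parts_narrow g 8 F"
    using F(2) induced_subgraph_verts[OF simple(1)[OF F(1)]] by (auto simp: small_parts_narrow_def g_def)
  then have "D' \<subset> D" using F(1) by (auto simp: D'_def)
  then have "bounded_treewidth D'"
    using minimal hereditary_small_parts_narrow[OF D(1)] unfolding D'_def by blast
  then obtain k where k: "\<And>G. G \<in> D' \<Longrightarrow> treewidth G \<le> k" by (auto simp: bounded_treewidth_def)
  obtain K where K: "\<And>P S. finite P \<Longrightarrow> finite S \<Longrightarrow> K < treewidth (path_star_subgraph \<alpha> P S) \<Longrightarrow>
    \<exists>C \<subseteq> S. spread g C \<and> k + 2 \<le> Suc (treewidth (path_star_subgraph \<alpha> P C))"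
    using wide_contains_spread_wide[of "k + 2" g] by auto
  obtain G where G: "G \<in> D" "K < treewidth G" using wide by blast
  then obtain P S where PS: "finite P" "finite S" "isomorphic G (path_star_subgraph \<alpha> P S)"
    using path_star_class_imp D(2) by blast
  have "treewidth (path_star_subgraph \<alpha> P S) = treewidth G"
    using isomorphic_treewidth_eq[OF PS(3) simple[OF G(1)] simple_path_star_subgraph] .
  then obtain C where C: "C \<subseteq> S" "spread g C" "k + 2 \<le> Suc (treewidth (path_star_subgraph \<alpha> P C))"
    using K[OF PS(1,2)] G(2) by auto
  obtain G' where G': "G' \<in> D" "isomorphic G' (path_star_subgraph \<alpha> P C)"
    using hereditary_path_star_subgraph[OF D(1) G(1) PS(3) C(1)] by blast
  have "finite C" using C(1) PS(2) finite_subset by blast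
  then have "small_parts_narrow g 8 G'"
    using small_parts_narrow_isomorphic[OF G'(2) simple[OF G'(1)] simple_path_star_subgraph]
      small_parts_narrow_if_spread[OF C(2) PS(1)] by blast
  then have "treewidth G' \<le> k" using k G'(1) by (simp add: D'_def)
  moreover have "treewidth (path_star_subgraph \<alpha> P C) = treewidth G'"
    using isomorphic_treewidth_eq[OF G'(2) simple[OF G'(1)] simple_path_star_subgraph] .
  ultimately show False using C(3) by simp
qed

end
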